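(* Let $k \in \mathbb{Z}^+$ be a positive integer and let $\mathbb{H}_k = \{(z_1,z_2)\in\mathbb{C}^2 : |z_1|^k < |z_2| < 1\}$. Then the Bergman kernel $\mathbb{B}_k$ of $\mathbb{H}_k$ is given, for all $z=(z_1,z_2), w=(w_1,w_2)\in\mathbb{H}_k$, by $$\mathbb{B}_k(z,w) = \frac{p_k(s)t^2 + q_k(s)t + s^k p_k(s)}{k\pi^2(1-t)^2(t-s^k)^2},$$ where $s := z_1\bar w_1$, $t := z_2\bar w_2$, and $p_k$, $q_k$ are the polynomials $$p_k(s) = \sum_{l=1}^{k-1} l(k-l)s^{l-1}, \qquad q_k(s) = \sum_{l=1}^{k}\bigl(l^2 + (k-l)^2 s^k\bigr)s^{l-1}.$$
   Context: For a domain $\Omega\subset\mathbb{C}^n$, the Bergman space $A^2(\Omega)$ is the Hilbert space of holomorphic functions on $\Omega$ that are square-integrable with respect to Lebesgue measure $dV$, with inner product $\langle f,g\rangle=\int_\Omega f\bar g\,dV$. The Bergman kernel of $\Omega$ is the function $\mathbb{B}_\Omega:\Omega\times\Omega\to\mathbb{C}$, given by the Riesz representation theorem, such that $\overline{\mathbb{B}_\Omega(z,\cdot)}\in A^2(\Omega)$ for each $z\in\Omega$ and $f(z)=\int_\Omega \mathbb{B}_\Omega(z,w)f(w)\,dV(w)$ for all $f\in A^2(\Omega)$, $z\in\Omega$. For $\gamma>0$, $\mathbb{H}_\gamma=\{(z_1,z_2)\in\mathbb{C}^2:|z_1|^\gamma<|z_2|<1\}$, and $\mathbb{B}_\gamma$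 denotes its Bergman kernel. Empty sums are $0$. *)

theory Defs
  imports "HOL-Analysis.Analysis"
begin

text \<open>
  A function of several complex variables is holomorphic if at each point it has a
  (Frechet) derivative that is complex linear. On complex vectors the operation
  \<^verbatim>\<open>*s\<close> is multiplication by complex scalars, whereas \<^const>\<open>has_derivative\<close>
  on its own requires linearity over the reals only.
\<close>

definition holomorphic_several_on :: "(complex ^ 'n \<Rightarrow> complex) \<Rightarrow> (complex ^ 'n) set \<Rightarrow> bool" where
  "holomorphic_several_on f \<Omega> \<longleftrightarrow>
     (\<forall>z\<in>\<Omega>. \<exists>D. (f has_derivative D) (at z within \<Omega>) \<and> (\<forall>c v. D (c *s v) = c * D v))"

text \<open>
  Functions on \<open>\<Omega>\<close> are total functions whose values outside \<open>\<Omega>\<close> are irrelevant.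
\<close>

definition bergman_space :: "(complex ^ 'n) set \<Rightarrow> (complex ^ 'n \<Rightarrow> complex) set" where
  "bergman_space \<Omega> =
     {f. holomorphic_several_on f \<Omega> \<and> set_integrable lborel \<Omega> (\<lambda>z. (cmod (f z))\<^sup>2)}"

definition is_bergman_kernel ::
    "(complex ^ 'n) set \<Rightarrow> (complex ^ 'n \<Rightarrow> complex ^ 'n \<Rightarrow> complex) \<Rightarrow> bool" where
  "is_bergman_kernel \<Omega> K \<longleftrightarrow>
     (\<forall>z\<in>\<Omega>. (\<lambda>w. cnj (K z w)) \<in> bergman_space \<Omega> \<and>
        (\<forall>f\<in>bergman_space \<Omega>. f z = (LINT w:\<Omega>|lborel. K z w * f w)))"

text \<open>
  The kernel is a function on \<open>\<Omega> \<times> \<Omega>\<close>, determined uniquely there for open \<open>\<Omega>\<close> (see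
  \<open>is_bergman_kernel_unique\<close> below); it is extended by \<open>0\<close> so that it is unique as a
  total function.
\<close>

definition bergman_kernel ::
    "(complex ^ 'n) set \<Rightarrow> complex ^ 'n \<Rightarrow> complex ^ 'n \<Rightarrow> complex" where
  "bergman_kernel \<Omega> =
     (THE K. is_bergman_kernel \<Omega> K \<and> (\<forall>z w. z \<notin> \<Omega> \<or> w \<notin> \<Omega> \<longrightarrow> K z w = 0))"

definition hartogs_triangle :: "real \<Rightarrow> (complex ^ 2) set" where
  "hartogs_triangle \<gamma> = {z. cmod (z $ 1) powr \<gamma> < cmod (z $ 2) \<and> cmod (z $ 2) < 1}"

definition p_poly :: "nat \<Rightarrow> complex \<Rightarrow> complex" where
  "p_poly k s = (\<Sum>l = 1..k - 1. of_nat l * of_nat (k - l) * s ^ (l - 1))"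

definition q_poly :: "nat \<Rightarrow> complex \<Rightarrow> complex" where
  "q_poly k s = (\<Sum>l = 1..k. (of_nat l ^ 2 + of_nat (k - l) ^ 2 * s ^ k) * s ^ (l - 1))"

lemma hartogs_triangle_of_nat:
  assumes "k > 0"
  shows "hartogs_triangle (real k) = {z. cmod (z $ 1) ^ k < cmod (z $ 2) \<and> cmod (z $ 2) < 1}"
proof -
  have "cmod a powr real k = cmod a ^ k" for a :: complex
    using assms by (cases "a = 0") (auto simp: powr_realpow)
  then show ?thesis
    by (simp add: hartogs_triangle_def)
qed

lemma holomorphic_several_on_imp_continuous_on:
  "holomorphic_several_on f \<Omega> \<Longrightarrow> continuous_on \<Omega> f"
  unfolding holomorphic_several_on_def continuous_on_eq_continuous_within
  by (meson has_derivative_continuous)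

lemma holomorphic_several_on_diff:
  assumes "holomorphic_several_on f \<Omega>" "holomorphic_several_on g \<Omega>"
  shows "holomorphic_several_on (\<lambda>z. f z - g z) \<Omega>"
  unfolding holomorphic_several_on_def
proof
  fix z assume "z \<in> \<Omega>"
  then obtain D E where D: "(f has_derivative D) (at z within \<Omega>)" "\<And>c v. D (c *s v) = c * D v"
    and E: "(g has_derivative E) (at z within \<Omega>)" "\<And>c v. E (c *s v) = c * E v"
    using assms unfolding holomorphic_several_on_def by metis
  show "\<exists>D. ((\<lambda>z. f z - g z) has_derivative D) (at z within \<Omega>) \<and> (\<forall>c v. D (c *s v) = c * D v)"
    using has_derivative_diff[OF D(1) E(1)] D(2) E(2)
    by (intro exI[of _ "\<lambda>v. D v - E v"]) (simp add: right_diff_distrib)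
qed

lemma set_integrable_mult_L2:
  fixes f g :: "complex ^ 'n \<Rightarrow> complex"
  assumes "open \<Omega>" "continuous_on \<Omega> f" "continuous_on \<Omega> g"
    and "set_integrable lborel \<Omega> (\<lambda>z. (cmod (f z))\<^sup>2)"
    and "set_integrable lborel \<Omega> (\<lambda>z. (cmod (g z))\<^sup>2)"
  shows "set_integrable lborel \<Omega> (\<lambda>z. f z * g z)"
proof -
  have "set_integrable lborel \<Omega> (\<lambda>z. (cmod (f z))\<^sup>2 + (cmod (g z))\<^sup>2)"
    using assms(4,5) by (rule set_integral_add)
  moreover have "set_borel_measurable lborel \<Omega> (\<lambda>z. f z * g z)"
    using borel_measurable_continuous_on_indicator[of \<Omega> "\<lambda>z. f z * g z"] assms(1-3)
    by (simp add: set_borel_measurable_def continuous_on_mult)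
  moreover have "cmod (f z * g z) \<le> (cmod (f z))\<^sup>2 + (cmod (g z))\<^sup>2" for z
  proof -
    have "2 * cmod (f z) * cmod (g z) \<le> (cmod (f z))\<^sup>2 + (cmod (g z))\<^sup>2"
      by (rule sum_squares_bound)
    moreover have "0 \<le> cmod (f z) * cmod (g z)"
      by simp
    ultimately show ?thesis
      unfolding norm_mult by linarith
  qed
  ultimately show ?thesis
    unfolding set_integrable_def set_borel_measurable_def
    by (elim Bochner_Integration.integrable_bound) (auto simp: indicator_def norm_mult)
qed

lemma bergman_space_diff:
  assumes "open \<Omega>" "f \<in> bergman_space \<Omega>" "g \<in> bergman_space \<Omega>"
  shows "(\<lambda>z. f z - g z) \<in> bergman_space \<Omega>"
proof -
  have hol: "holomorphic_several_on (\<lambda>z. f z - g z) \<Omega>"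
    using assms by (simp add: bergman_space_def holomorphic_several_on_diff)
  have "set_integrable lborel \<Omega> (\<lambda>z. 2 * (cmod (f z))\<^sup>2 + 2 * (cmod (g z))\<^sup>2)"
    using assms by (intro set_integral_add set_integrable_mult_right) (auto simp: bergman_space_def)
  moreover have "set_borel_measurable lborel \<Omega> (\<lambda>z. (cmod (f z - g z))\<^sup>2)"
    using borel_measurable_continuous_on_indicator[of \<Omega> "\<lambda>z. (cmod (f z - g z))\<^sup>2"] assms(1)
      holomorphic_several_on_imp_continuous_on[OF hol]
    by (simp add: set_borel_measurable_def continuous_intros)
  moreover have "(cmod (f z - g z))\<^sup>2 \<le> 2 * (cmod (f z))\<^sup>2 + 2 * (cmod (g z))\<^sup>2" for z
  proof -
    have "(cmod (f z - g z))\<^sup>2 \<le> (cmod (f z) + cmod (g z))\<^sup>2"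
      by (intro power_mono norm_triangle_ineq4) simp
    moreover have "2 * cmod (f z) * cmod (g z) \<le> (cmod (f z))\<^sup>2 + (cmod (g z))\<^sup>2"
      by (rule sum_squares_bound)
    ultimately show ?thesis
      by (simp add: power2_sum)
  qed
  ultimately have "set_integrable lborel \<Omega> (\<lambda>z. (cmod (f z - g z))\<^sup>2)"
    unfolding set_integrable_def set_borel_measurable_def
    by (elim Bochner_Integration.integrable_bound) (auto simp: indicator_def)
  with hol show ?thesis
    by (simp add: bergman_space_def)
qed

lemma is_bergman_kernel_unique:
  assumes "open \<Omega>" "is_bergman_kernel \<Omega> K" "is_bergman_kernel \<Omega> L" "z \<in> \<Omega>" "w \<in> \<Omega>"
  shows "K z w = L z w"
proof -
  define h where "h = (\<lambda>w. cnj (K z w) - cnj (L z w))"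
  have K: "(\<lambda>w. cnj (K z w)) \<in> bergman_space \<Omega>" and L: "(\<lambda>w. cnj (L z w)) \<in> bergman_space \<Omega>"
    using assms by (auto simp: is_bergman_kernel_def)
  have h: "h \<in> bergman_space \<Omega>"
    unfolding h_def using assms(1) K L by (rule bergman_space_diff)
  have cont: "continuous_on \<Omega> f" if "f \<in> bergman_space \<Omega>" for f
    using that by (simp add: bergman_space_def holomorphic_several_on_imp_continuous_on)
  have int: "set_integrable lborel \<Omega> (\<lambda>w. M w * h w)" if M: "(\<lambda>w. cnj (M w)) \<in> bergman_space \<Omega>" for M
  proof (rule set_integrable_mult_L2[OF assms(1) _ cont[OF h]])
    have "continuous_on \<Omega> (\<lambda>w. cnj (cnj (M w)))"
      by (intro continuous_on_cnj cont M)
    then show "continuous_on \<Omega> M" by simp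
  qed (use M h in \<open>auto simp: bergman_space_def\<close>)
  have "(LINT w:\<Omega>|lborel. K z w * h w) = h z" "(LINT w:\<Omega>|lborel. L z w * h w) = h z"
    using assms h by (auto simp: is_bergman_kernel_def)
  then have "0 = (LINT w:\<Omega>|lborel. K z w * h w - L z w * h w)"
    using set_integral_diff(2)[OF int[OF K] int[OF L]] by simp
  also have "\<dots> = (LINT w:\<Omega>|lborel. of_real ((cmod (h w))\<^sup>2))"
  proof -
    have "K z w * h w - L z w * h w = of_real ((cmod (h w))\<^sup>2)" for w
      unfolding complex_norm_square h_def by (simp add: algebra_simps)
    then show ?thesis by presburger
  qed
  also have "\<dots> = of_real (LINT w:\<Omega>|lborel. (cmod (h w))\<^sup>2)"
    by (rule set_integral_complex_of_real)
  finally have "(LINT w:\<Omega>|lborel. (cmod (h w))\<^sup>2) = 0"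
    by simp
  moreover have "set_integrable lborel \<Omega> (\<lambda>w. (cmod (h w))\<^sup>2)"
    using h by (simp add: bergman_space_def)
  ultimately have "AE w in lborel. indicator \<Omega> w *\<^sub>R (cmod (h w))\<^sup>2 = 0"
    unfolding set_lebesgue_integral_def set_integrable_def
    by (subst (asm) integral_nonneg_eq_0_iff_AE) auto
  then have ae: "AE w in lborel. w \<notin> \<Omega> \<or> h w = 0"
    by eventually_elim (auto simp: indicator_def split: if_splits)
  define U where "U = {w \<in> \<Omega>. h w \<noteq> 0}"
  have "open U"
  proof -
    have "U = \<Omega> \<inter> h -` (- {0})" by (auto simp: U_def)
    then show ?thesis
      using continuous_open_preimage[OF cont[OF h] assms(1), of "- {0}"] by (simp add: open_Compl)
  qed
  moreover have "AE w in lborel. w \<notin> U"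
    using ae by eventually_elim (auto simp: U_def)
  ultimately have "emeasure lborel U = 0"
    using AE_iff_measurable[of U lborel "\<lambda>w. w \<notin> U"] by auto
  then have "negligible U"
    using \<open>open U\<close> by (simp add: negligible_iff_emeasure0)
  with \<open>open U\<close> have "U = {}"
    using open_not_negligible by blast
  with assms(5) have "h w = 0"
    by (auto simp: U_def)
  then show ?thesis
    by (simp add: h_def)
qed

end

theory Submission
  imports Defs "HOL-Complex_Analysis.Complex_Analysis"
begin

text \<open>
  The kernel is the sum over an orthogonal basis of monomials. On the Hartogs triangle the
  squared norm of \<open>z\<^sub>1\<^sup>n z\<^sub>2\<^sup>m\<close> is
  \<open>k \<pi>\<^sup>2 / ((n + 1) (k (m + 1) + n + 1))\<close>, provided that \<open>k (m + 1) + n + 1 > 0\<close>; the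
  other monomials are not square integrable. With \<open>s = z\<^sub>1 cnj w\<^sub>1\<close> and
  \<open>t = z\<^sub>2 cnj w\<^sub>2\<close> this gives the kernel as the sum of
  \<open>(n + 1) (k (m + 1) + n + 1) s\<^sup>n t\<^sup>m / (k \<pi>\<^sup>2)\<close>. Write \<open>n = k \<alpha> + i\<close>
  with \<open>0 \<le> i < k\<close>, and put \<open>\<beta> = m + 1 + \<alpha>\<close>. The condition on the exponents then becomes
  \<open>\<beta> \<ge> 0\<close>, and for each \<open>i\<close> the double sum splits into a product of two geometric-type sums,
  
  \<open>s\<^sup>i (\<Sum>\<alpha>. (k \<alpha> + i + 1) (s\<^sup>k/t)\<^sup>\<alpha>) (\<Sum>\<beta>. (k \<beta> + i + 1) t\<^sup>\<beta>) / t\<close>.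
  
  Adding the closed forms of the \<open>k\<close> products gives the rational function of the theorem
  (\<open>hartogs_kernel_closed_form\<close>).
  
  The reproducing property is proved directly, without Hilbert space bases, by integrating first
  over the discs \<open>cmod z\<^sub>1 < cmod z\<^sub>2 powr (1 / k)\<close> and then over the punctured unit disc.
  The inner integral picks out the \<open>n\<close>-th Taylor coefficient \<open>f\<^sub>n(z\<^sub>2)\<close> of \<open>f\<close> in
  the variable \<open>z\<^sub>1\<close> (\<open>holomorphic_moment\<close>). This coefficient is holomorphic in
  \<open>z\<^sub>2\<close> on the punctured disc (\<open>holomorphic_on_fibre_coeff\<close>), and by Bessel's inequality the
  product of \<open>f\<^sub>n\<close> with the power \<open>\<alpha> + 1\<close> of \<open>z\<^sub>2\<close> is square integrable for the weight
  \<open>cmod z\<^sub>2 powr (2 \<nu> - 2)\<close>, where \<open>\<nu> = (i + 1) / k\<close>. As \<open>\<nu> \<le> 1\<close>, the singularity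
  at the origin is removable (\<open>square_integrable_removable\<close>); this is how the
  inadmissible monomials disappear. The outer integral is then the reproducing formula of a
  weighted Bergman space on the unit disc (\<open>weighted_disc_reproducing\<close>), whose kernel is the
  second factor of the product above. Summing over \<open>\<alpha>\<close> and \<open>i\<close> restores the Taylor series of
  \<open>f\<close> along the fibre through \<open>z\<close> (\<open>hartogs_kernel_reproducing\<close>). On the Hartogs
  triangle, the exchanges of sums and integrals are dominated by a multiple of \<open>cmod (f w / w $ 2)\<close>, which is integrable because
  \<open>1 / w $ 2\<close> is square integrable on the Hartogs triangle
  (\<open>square_integrable_inverse_second\<close>). The same bound puts the kernel into the Bergman space, and
  uniqueness of the kernel finishes the proof.
\<close>

section \<open>Lebesgue measure under coordinate changes and rotations\<close>
text \<open>
  Coordinates with respect to the two bases correspond, so the preimage of a box is a box with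
  the same side lengths, and boxes determine Lebesgue measure. This covers both
  \<open>\<real>\<^sup>2 \<cong> \<complex>\<close> and \<open>\<complex> \<times> \<complex> \<cong> \<complex>\<^sup>2\<close>.
\<close>

lemma lborel_distr_basis:
  fixes \<phi> :: "'a::euclidean_space \<Rightarrow> 'b::euclidean_space"
  assumes lin: "linear \<phi>" and bij: "bij_betw \<phi> Basis Basis"
  shows "distr lborel borel \<phi> = lborel"
proof (rule sym, rule lborel_eqI)
  have [measurable]: "\<phi> \<in> borel_measurable borel"
    using lin by (intro borel_measurable_continuous_onI linear_continuous_on) (simp add: linear_conv_bounded_linear)
  have B: "Basis = \<phi> ` Basis" and inj: "inj_on \<phi> Basis"
    using bij by (auto simp: bij_betw_def)
  have inner: "\<phi> x \<bullet> \<phi> b = x \<bullet> b" if b: "b \<in> Basis" for x b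
  proof -
    have "\<phi> x = \<phi> (\<Sum>c\<in>Basis. (x \<bullet> c) *\<^sub>R c)"
      by (simp add: euclidean_representation)
    also have "\<dots> = (\<Sum>c\<in>Basis. (x \<bullet> c) *\<^sub>R \<phi> c)"
      by (simp add: linear_sum[OF lin] linear_cmul[OF lin])
    finally have "\<phi> x \<bullet> \<phi> b = (\<Sum>c\<in>Basis. (x \<bullet> c) * (\<phi> c \<bullet> \<phi> b))"
      by (simp add: inner_sum_left)
    also have "\<dots> = (\<Sum>c\<in>Basis. if c = b then x \<bullet> c else 0)"
    proof (intro sum.cong refl)
      fix c :: 'a assume c: "c \<in> Basis"
      have "\<phi> c \<in> Basis" "\<phi> b \<in> Basis" using b c B by auto
      then have "\<phi> c \<bullet> \<phi> b = (if \<phi> c = \<phi> b then 1 else 0)"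
        by (rule inner_Basis)
      then show "(x \<bullet> c) * (\<phi> c \<bullet> \<phi> b) = (if c = b then x \<bullet> c else 0)"
        using inj b c by (auto simp: inj_on_def)
    qed
    finally show ?thesis using b by simp
  qed
  fix l u :: 'b assume le: "\<And>b. b \<in> Basis \<Longrightarrow> l \<bullet> b \<le> u \<bullet> b"
  define L where "L v = (\<Sum>c\<in>Basis. (v \<bullet> \<phi> c) *\<^sub>R c)" for v
  have L: "L v \<bullet> b = v \<bullet> \<phi> b" if "b \<in> Basis" for v b
    using that by (simp add: L_def)
  have "\<phi> -` box l u = box (L l) (L u)"
    by (subst box_def, subst B) (auto simp: box_def L inner)
  then have "emeasure (distr lborel borel \<phi>) (box l u) = emeasure lborel (box (L l) (L u))"
    by (simp add: emeasure_distr)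
  also have "\<dots> = (\<Prod>b\<in>Basis. (L u - L l) \<bullet> b)"
  proof (rule emeasure_lborel_box)
    fix b :: 'a assume "b \<in> Basis"
    moreover from this have "\<phi> b \<in> Basis" using B by blast
    ultimately show "L l \<bullet> b \<le> L u \<bullet> b" using le[of "\<phi> b"] by (simp add: L)
  qed
  also have "(\<Prod>b\<in>Basis. (L u - L l) \<bullet> b) = (\<Prod>b\<in>Basis. (u - l) \<bullet> \<phi> b)"
    by (intro prod.cong) (auto simp: L inner_diff_left)
  also have "\<dots> = (\<Prod>b\<in>Basis. (u - l) \<bullet> b)"
    using prod.reindex_bij_betw[OF bij, of "\<lambda>b. (u - l) \<bullet> b"] by simp
  finally show "emeasure (distr lborel borel \<phi>) (box l u) = (\<Prod>b\<in>Basis. (u - l) \<bullet> b)" .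
qed simp

text \<open>
  Transported to \<open>\<real>\<^sup>2\<close>, the rotation is an orthogonal transformation and so preserves
  the measure of every box.
\<close>

lemma lborel_distr_complex_rotation:
  fixes c :: complex
  assumes c: "cmod c = 1"
  shows "distr lborel borel ((*) c) = lborel"
proof (rule sym, rule lborel_eqI)
  define \<psi> :: "real ^ 2 \<Rightarrow> complex" where "\<psi> v = Complex (v $ 1) (v $ 2)" for v
  define \<rho> :: "real ^ 2 \<Rightarrow> real ^ 2" where
    "\<rho> v = vector [Re (cnj c * \<psi> v), Im (cnj c * \<psi> v)]" for v
  have psi: "distr lborel borel \<psi> = lborel"
  proof (rule lborel_distr_basis)
    show "linear \<psi>"
      by (rule linearI) (auto simp: \<psi>_def complex_eq_iff)
    have 2: "(UNIV :: 2 set) = {1, 2}" by (rule UNIV_2)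
    have 3: "Basis = {axis 1 1, axis 2 1 :: real ^ 2}"
      by (auto simp: Basis_vec_def 2)
    have "\<psi> (axis 1 1) = 1" "\<psi> (axis 2 1) = \<i>"
      by (auto simp: \<psi>_def complex_eq_iff axis_def)
    then show "bij_betw \<psi> Basis Basis"
      unfolding bij_betw_def 3 by (auto simp: inj_on_def Basis_complex_def complex_eq_iff)
  qed
  have psi_rho: "\<psi> (\<rho> v) = cnj c * \<psi> v" for v
    by (simp add: \<psi>_def \<rho>_def complex_eq_iff)
  have cc: "c * cnj c = 1"
    using c by (simp add: complex_norm_square[symmetric])
  have norm_psi: "cmod (\<psi> v) = norm v" for v
    by (simp add: \<psi>_def cmod_def norm_vec_def L2_set_def sum_2)
  have lin: "linear \<rho>"
    by (rule linearI) (simp_all add: \<rho>_def \<psi>_def vec_eq_iff forall_2 algebra_simps)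
  have orth: "orthogonal_transformation \<rho>"
    unfolding orthogonal_transformation using lin
    by (auto simp: norm_psi[symmetric] psi_rho norm_mult c)
  have [measurable]: "\<psi> \<in> borel_measurable borel"
    unfolding \<psi>_def by (auto intro!: borel_measurable_continuous_onI continuous_intros)
  fix l u :: complex assume le: "\<And>b. b \<in> Basis \<Longrightarrow> l \<bullet> b \<le> u \<bullet> b"
  define S where "S = \<psi> -` box l u"
  have emeasure_psi: "emeasure lborel A = emeasure lborel (\<psi> -` A)" if "A \<in> sets borel" for A
    using that by (subst psi[symmetric]) (simp add: emeasure_distr)
  have [measurable]: "S \<in> sets borel"
    unfolding S_def by (rule measurable_sets_borel[where M = borel]) auto
  have eS: "emeasure lborel S = emeasure lborel (box l u)"
    by (simp add: S_def emeasure_psi[symmetric])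
  have lm: "S \<in> lmeasurable"
    using eS emeasure_lborel_box_finite[of l u] by (intro fmeasurableI) auto
  have img: "(\<psi> -` ((*) c -` box l u)) = \<rho> ` S"
  proof (intro equalityI subsetI)
    fix v assume "v \<in> \<psi> -` ((*) c -` box l u)"
    then have v: "c * \<psi> v \<in> box l u" by simp
    obtain s where s: "v = \<rho> s"
      using orthogonal_transformation_surj[OF orth] by (metis surjD)
    have "c * \<psi> v = \<psi> s" using cc by (simp add: s psi_rho mult.assoc[symmetric])
    then have "s \<in> S" using v by (simp add: S_def)
    then show "v \<in> \<rho> ` S" using s by blast
  next
    fix v assume "v \<in> \<rho> ` S"
    then obtain s where s: "v = \<rho> s" "\<psi> s \<in> box l u" by (auto simp: S_def)
    have "c * \<psi> v = \<psi> s" using cc by (simp add: s(1) psi_rho mult.assoc[symmetric])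
    then show "v \<in> \<psi> -` ((*) c -` box l u)" using s(2) by simp
  qed
  have rm: "\<rho> ` S \<in> lmeasurable" and req: "measure lebesgue (\<rho> ` S) = measure lebesgue S"
    using measurable_orthogonal_image[OF orth lm] measure_orthogonal_image[OF orth lm] by auto
  have m: "(*) c -` box l u \<in> sets borel"
    by (rule measurable_sets_borel[where M = borel]) auto
  have m2: "\<rho> ` S \<in> sets borel"
    unfolding img[symmetric] by (rule measurable_sets_borel[where M = borel, OF _ m]) auto
  have "emeasure (distr lborel borel ((*) c)) (box l u) = emeasure lborel (\<rho> ` S)"
    using emeasure_psi[OF m] by (simp add: emeasure_distr img)
  also have "\<dots> = emeasure lborel S"
  proof -
    have leb: "emeasure lborel T = ennreal (measure lebesgue T)"
      if "T \<in> lmeasurable" "T \<in> sets borel" for T :: "(real ^ 2) set"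
    proof -
      have "emeasure lborel T = emeasure lebesgue T"
        using that(2) by simp
      also have "\<dots> = ennreal (measure lebesgue T)"
        using that(1) by (rule emeasure_eq_measure2)
      finally show ?thesis .
    qed
    show ?thesis
      by (simp only: leb[OF rm m2] leb[OF lm \<open>S \<in> sets borel\<close>] req)
  qed
  also have "\<dots> = (\<Prod>b\<in>Basis. (u - l) \<bullet> b)"
    using eS le by simp
  finally show "emeasure (distr lborel borel ((*) c)) (box l u) = (\<Prod>b\<in>Basis. (u - l) \<bullet> b)" .
qed simp

section \<open>Powers of the modulus on a disc\<close>
text \<open>
  Polar coordinates for radial functions: for \<open>0 \<le> x < R\<close>, both measures give the half-line beyond
  \<open>x\<close> the area \<open>\<pi>(R\<^sup>2 - x\<^sup>2)\<close> of an annulus.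
\<close>

lemma distr_norm_disc:
  assumes R: "R > 0"
  shows "distr (density lborel (indicator (ball 0 R))) borel (cmod :: complex \<Rightarrow> real) =
         density lborel (\<lambda>r. ennreal (2 * pi * r) * indicator {0<..<R} r)" (is "?M = ?N")
proof (rule measure_eqI_lessThan)
  have [measurable]: "(indicator (ball (0::complex) R) :: _ \<Rightarrow> ennreal) \<in> borel_measurable borel"
    by (rule borel_measurable_indicator) simp
  have b: "emeasure lborel (ball (0::complex) r) = ennreal (pi * r\<^sup>2)" if "r \<ge> 0" for r
    using that by (simp add: emeasure_ball unit_ball_vol_2 DIM_complex)
  have c: "emeasure lborel (cball (0::complex) r) = ennreal (pi * r\<^sup>2)" if "r \<ge> 0" for r
    using that by (simp add: emeasure_cball unit_ball_vol_2 DIM_complex)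
  have M: "emeasure ?M {x<..} = (if x \<ge> R then 0 else ennreal (pi * (R\<^sup>2 - (max x 0)\<^sup>2)))" for x
  proof -
    have meas: "cmod -` {x<..} \<in> sets borel"
      by (rule measurable_sets_borel[where M = borel]) auto
    have "emeasure ?M {x<..} = emeasure (density lborel (indicator (ball 0 R))) (cmod -` {x<..})"
      by (subst emeasure_distr) auto
    also have "\<dots> = (\<integral>\<^sup>+w. indicator (ball 0 R) w * indicator (cmod -` {x<..}) w \<partial>lborel)"
      by (rule emeasure_density) (use meas in simp_all)
    also have "\<dots> = (\<integral>\<^sup>+w. indicator (ball 0 R \<inter> cmod -` {x<..}) w \<partial>lborel)"
      by (simp add: indicator_inter_arith)
    also have "\<dots> = emeasure lborel (ball 0 R \<inter> cmod -` {x<..})"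
      by (rule nn_integral_indicator) (simp add: sets.Int meas)
    also have "\<dots> = (if x \<ge> R then 0 else ennreal (pi * (R\<^sup>2 - (max x 0)\<^sup>2)))"
    proof -
      consider "x \<ge> R" | "x < 0" | "0 \<le> x" "x < R" by linarith
      then show ?thesis
      proof cases
        case 1
        then have "ball 0 R \<inter> cmod -` {x<..} = {}" by auto
        with 1 show ?thesis by simp
      next
        case 2
        then have "ball 0 R \<inter> cmod -` {x<..} = ball 0 R" by (auto intro: less_le_trans[OF _ norm_ge_zero])
        with 2 R b[of R] show ?thesis by (simp add: max_def)
      next
        case 3
        then have "ball 0 R \<inter> cmod -` {x<..} = ball 0 R - cball 0 x" by auto
        moreover have "emeasure lborel (ball (0::complex) R - cball 0 x) =
            emeasure lborel (ball (0::complex) R) - emeasure lborel (cball (0::complex) x)"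
          by (rule emeasure_Diff) (use 3 c[of x] in auto)
        ultimately show ?thesis
          using 3 R b[of R] c[of x] by (simp add: max_def ennreal_minus right_diff_distrib)
      qed
    qed
    finally show ?thesis .
  qed
  have N: "emeasure ?N {x<..} = (if x \<ge> R then 0 else ennreal (pi * (R\<^sup>2 - (max x 0)\<^sup>2)))" for x
  proof -
    define y where "y = max x 0"
    have "emeasure ?N {x<..} = (\<integral>\<^sup>+r. ennreal (2 * pi * r) * indicator {0<..<R} r * indicator {x<..} r \<partial>lborel)"
      by (rule emeasure_density) auto
    also have "\<dots> = (if x \<ge> R then 0 else ennreal (pi * (R\<^sup>2 - y\<^sup>2)))"
    proof (cases "x \<ge> R")
      case True
      then have "(\<lambda>r. ennreal (2 * pi * r) * indicator {0<..<R} r * indicator {x<..} r) = (\<lambda>_. 0)"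
        by (auto simp: fun_eq_iff indicator_def)
      with True show ?thesis by simp
    next
      case False
      have "(\<integral>\<^sup>+r. ennreal (2 * pi * r) * indicator {0<..<R} r * indicator {x<..} r \<partial>lborel) =
            (\<integral>\<^sup>+r. ennreal (2 * pi * r) * indicator {y..R} r \<partial>lborel)"
      proof (rule nn_integral_cong_AE)
        show "AE r in lborel. ennreal (2 * pi * r) * indicator {0<..<R} r * indicator {x<..} r =
            ennreal (2 * pi * r) * indicator {y..R} r"
          using AE_lborel_singleton[of y] AE_lborel_singleton[of R]
          by eventually_elim (auto simp: indicator_def y_def max_def split: if_splits)
      qed
      also have "\<dots> = ennreal (pi * R\<^sup>2 - pi * y\<^sup>2)"
        by (rule nn_integral_FTC_Icc) (use False R in \<open>auto simp: y_def intro!: derivative_eq_intros\<close>)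
      finally show ?thesis using False by (simp add: right_diff_distrib)
    qed
    finally show ?thesis by (simp add: y_def)
  qed
  show "emeasure ?M {x<..} < \<infinity>" "emeasure ?M {x<..} = emeasure ?N {x<..}" for x
    unfolding M N by auto
qed auto

text \<open>
  In polar coordinates the integrand becomes \<open>2 \<pi> r powr (2 * \<mu> - 1)\<close>. The condition
  \<open>\<mu> > 0\<close> is exactly integrability at the centre, where the weight may be unbounded.
\<close>

lemma
  assumes R: "R > 0" and \<mu>: "\<mu> > 0"
  shows set_integrable_cmod_powr_disc:
      "set_integrable lborel (ball 0 R) (\<lambda>w::complex. cmod w powr (2 * \<mu> - 2))" (is ?A)
    and integral_cmod_powr_disc:
      "(LINT w:ball 0 R|lborel. (cmod w :: real) powr (2 * \<mu> - 2)) = pi * R powr (2 * \<mu>) / \<mu>" (is ?B)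
proof -
  have [measurable]: "(indicator (ball (0::complex) R) :: _ \<Rightarrow> ennreal) \<in> borel_measurable borel"
      "(indicator (ball (0::complex) R) :: _ \<Rightarrow> real) \<in> borel_measurable borel"
    by (rule borel_measurable_indicator, simp)+
  define F where "F r = pi / \<mu> * r powr (2 * \<mu>)" for r :: real
  define f where "f r = 2 * pi * r * r powr (2 * \<mu> - 2)" for r :: real
  have lim0: "((F \<circ> real_of_ereal) \<longlongrightarrow> 0) (at_right 0)"
  proof -
    have "(F \<longlongrightarrow> 0) (at_right 0)"
      unfolding F_def using \<mu> by real_asymp
    then show ?thesis by (simp add: ereal_tendsto_simps zero_ereal_def)
  qed
  have limR: "((F \<circ> real_of_ereal) \<longlongrightarrow> F R) (at_left (ereal R))"
  proof -
    have "isCont F R" unfolding F_def using R by (intro continuous_intros) auto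
    then have "(F \<longlongrightarrow> F R) (at_left R)"
      using isCont_def filterlim_at_split by blast
    then show ?thesis by (simp add: ereal_tendsto_simps)
  qed
  have der: "DERIV F r :> f r" if "0 < r" for r
  proof -
    have "DERIV F r :> pi / \<mu> * (2 * \<mu> * r powr (2 * \<mu> - 1))"
      unfolding F_def using that by (auto intro!: derivative_eq_intros)
    also have "r powr (2 * \<mu> - 1) = r * r powr (2 * \<mu> - 2)"
      using that by (simp add: powr_mult_base)
    finally show ?thesis using \<mu> by (simp add: f_def mult_ac)
  qed
  have cont: "isCont f r" if "0 < r" for r
    unfolding f_def using that by (intro continuous_intros) auto
  have "(0::ereal) < ereal R" using R by simp
  note FTC = interval_integral_FTC_nonneg[of 0 "ereal R" F f 0 "F R", OF this _ _ _ lim0 limR]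
  have int: "set_integrable lborel (einterval 0 (ereal R)) f" and val: "(LBINT r=0..ereal R. f r) = F R"
    using FTC der cont by (auto simp: f_def)
  have ein: "einterval 0 (ereal R) = {0<..<R}"
    by (auto simp: einterval_def)
  have int: "integrable lborel (\<lambda>r. indicator {0<..<R} r *\<^sub>R f r)"
    using int by (simp add: set_integrable_def ein)
  have val: "(LINT r|lborel. indicator {0<..<R} r *\<^sub>R f r) = F R"
    using val R by (simp add: interval_lebesgue_integral_def set_lebesgue_integral_def ein)
  define D where "D = density lborel (indicator (ball 0 R) :: complex \<Rightarrow> ennreal)"
  define E where "E = density lborel (\<lambda>r. ennreal (2 * pi * r * indicator {0<..<R} r))"
  have E: "E = distr D borel cmod"
    unfolding D_def E_def distr_norm_disc[OF R]
    by (intro density_cong) (auto simp: indicator_def)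
  have "integrable E (\<lambda>r. r powr (2 * \<mu> - 2))"
    unfolding E_def
    by (subst integrable_density) (use int in \<open>auto simp: f_def indicator_def mult_ac split: if_splits cong: if_cong\<close>)
  then have 1: "integrable D (\<lambda>w. cmod w powr (2 * \<mu> - 2))"
    unfolding E by (subst (asm) integrable_distr_eq) (auto simp: D_def)
  have D: "D = density lborel (\<lambda>w. ennreal (indicator (ball 0 R) w))"
    unfolding D_def by (intro density_cong) (auto simp: indicator_def)
  show ?A
    using 1 unfolding D set_integrable_def
    by (subst (asm) integrable_density) auto
  have "(LINT w:ball 0 R|lborel. (cmod w :: real) powr (2 * \<mu> - 2)) = (LINT w|D. cmod w powr (2 * \<mu> - 2))"
    unfolding D set_lebesgue_integral_def
    by (subst integral_density) auto
  also have "\<dots> = (LINT r|E. r powr (2 * \<mu> - 2))"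
    unfolding E by (subst integral_distr) (auto simp: D_def)
  also have "\<dots> = F R"
    unfolding E_def val[symmetric]
    by (subst integral_density) (auto simp: f_def indicator_def intro!: Bochner_Integration.integral_cong)
  finally show ?B by (simp add: F_def)
qed

section \<open>Moments of holomorphic functions on a disc\<close>
lemma borel_measurable_cnj [measurable]: "cnj \<in> borel_measurable borel"
  by (intro borel_measurable_continuous_onI continuous_intros)

lemma ball_sets_borel [measurable]: "ball (c :: 'a :: real_normed_vector) r \<in> sets borel"
  by simp

definition taylor_coeff :: "(complex \<Rightarrow> complex) \<Rightarrow> nat \<Rightarrow> complex" where
  "taylor_coeff h n = (deriv ^^ n) h 0 / fact n"

lemma taylor_coeff_sums:
  assumes "h holomorphic_on ball 0 R" "cmod w < R"
  shows "(\<lambda>n. taylor_coeff h n * w ^ n) sums h w"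
  using holomorphic_power_series[OF assms(1), of w] assms(2) by (simp add: taylor_coeff_def)

lemma taylor_coeff_abs_summable:
  assumes "h holomorphic_on ball 0 R" "0 \<le> r" "r < R"
  shows "summable (\<lambda>n. cmod (taylor_coeff h n) * r ^ n)"
proof -
  define \<rho> where "\<rho> = (r + R) / 2"
  have "0 < \<rho>" "r < \<rho>" "\<rho> < R"
    using assms by (auto simp: \<rho>_def)
  then have "cmod (of_real \<rho>) < R" "cmod (of_real r) < cmod (of_real \<rho> :: complex)"
    using assms by auto
  with powser_insidea[OF sums_summable[OF taylor_coeff_sums[OF assms(1)]], of "of_real \<rho>" "of_real r"]
  show ?thesis using assms(2) by (simp add: norm_mult norm_power)
qed

text \<open>
  The rotation by the angle \<open>\<pi> / (m - n)\<close> multiplies the integrand by \<open>-1\<close> but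
  preserves the integral.
\<close>

lemma disc_orthogonality:
  assumes "m \<noteq> n"
  shows "(LINT w:ball 0 R|lborel. of_real (cmod w powr a) * (cnj w ^ n * w ^ m)) = 0"
proof -
  define \<theta> where "\<theta> = pi / (real m - real n)"
  define c where "c = cis \<theta>"
  define g where "g w = indicator (ball 0 R) w *\<^sub>R (of_real (cmod w powr a) * (cnj w ^ n * w ^ m))"
    for w :: complex
  have [measurable]: "g \<in> borel_measurable borel"
    unfolding g_def by measurable
  have "real m * \<theta> - real n * \<theta> = (real m - real n) * \<theta>"
    by (simp add: left_diff_distrib)
  also have "\<dots> = pi"
    using assms by (simp add: \<theta>_def)
  finally have "real m * \<theta> - real n * \<theta> = pi" .
  then have "cnj c ^ n * c ^ m = -1"
    by (simp add: c_def cis_cnj Complex.DeMoivre cis_mult)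
  moreover have "cmod c = 1" by (simp add: c_def)
  ultimately have rot: "g (c * w) = - g w" for w
  proof -
    have "cnj (c * w) ^ n * (c * w) ^ m = (cnj c ^ n * c ^ m) * (cnj w ^ n * w ^ m)"
      by (simp add: power_mult_distrib)
    with \<open>cnj c ^ n * c ^ m = -1\<close> \<open>cmod c = 1\<close> show ?thesis
      by (simp add: g_def norm_mult indicator_def)
  qed
  have "(LINT w|lborel. g w) = (LINT w|distr lborel borel ((*) c). g w)"
    using \<open>cmod c = 1\<close> by (simp add: lborel_distr_complex_rotation)
  also have "\<dots> = (LINT w|lborel. g (c * w))"
    by (subst integral_distr) auto
  finally have "(LINT w|lborel. g w) = 0"
    by (simp add: rot)
  then show ?thesis by (simp add: g_def set_lebesgue_integral_def)
qed

lemma disc_monomial_norm: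
  assumes R: "R > 0" and \<nu>: "\<nu> > 0"
  shows "(LINT w:ball 0 R|lborel. of_real (cmod w powr (2 * \<nu> - 2)) * (cnj w ^ n * w ^ n)) =
    of_real (pi * R powr (2 * (real n + \<nu>)) / (real n + \<nu>))"
proof -
  have "of_real (cmod w powr (2 * \<nu> - 2)) * (cnj w ^ n * w ^ n) =
        complex_of_real (cmod w powr (2 * (real n + \<nu>) - 2))" for w
  proof (cases "w = 0")
    case False
    have "cnj w ^ n * w ^ n = of_real ((cmod w)\<^sup>2) ^ n"
      unfolding complex_norm_square by (simp add: power_mult_distrib mult_ac)
    also have "\<dots> = of_real (cmod w powr (2 * real n))"
      using False by (simp add: powr_realpow power_mult flip: powr_numeral powr_powr of_real_power)
    finally show ?thesis using False
      by (simp add: algebra_simps flip: powr_add of_real_mult)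
  qed simp
  then have "(LINT w:ball 0 R|lborel. of_real (cmod w powr (2 * \<nu> - 2)) * (cnj w ^ n * w ^ n)) =
     (LINT w:ball (0::complex) R|lborel. complex_of_real (cmod w powr (2 * (real n + \<nu>) - 2)))"
    by presburger
  also have "\<dots> = of_real (LINT w:ball (0::complex) R|lborel. cmod w powr (2 * (real n + \<nu>) - 2))"
    by (rule set_integral_complex_of_real)
  also have "\<dots> = of_real (pi * R powr (2 * (real n + \<nu>)) / (real n + \<nu>))"
    using R \<nu> by (subst integral_cmod_powr_disc) auto
  finally show ?thesis .
qed

text \<open>
  On a smaller disc the Taylor series converges absolutely and uniformly and may be
  integrated term by term; orthogonality leaves a single term.
\<close>

lemma holomorphic_moment_smaller_disc:
  assumes h: "h holomorphic_on ball 0 R" and r: "0 < r" "r < R" and \<nu>: "\<nu> > 0"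
  shows "(LINT w:ball 0 r|lborel. of_real (cmod w powr (2 * \<nu> - 2)) * (cnj w ^ n * h w)) =
    taylor_coeff h n * of_real (pi * r powr (2 * (real n + \<nu>)) / (real n + \<nu>))" (is "?L = _")
proof -
  define c where "c = taylor_coeff h"
  define F where "F i w = indicator (ball 0 r) w *\<^sub>R
      (of_real (cmod w powr (2 * \<nu> - 2)) * (cnj w ^ n * (c i * w ^ i)))" for i and w :: complex
  define G where "G w = indicator (ball 0 r) w *\<^sub>R (cmod w powr (2 * \<nu> - 2))" for w :: complex
  have G: "integrable lborel G"
    using set_integrable_cmod_powr_disc[OF r(1) \<nu>] by (simp add: G_def [abs_def] set_integrable_def)
  have [measurable]: "F i \<in> borel_measurable borel" for i
    unfolding F_def by measurable
  have bound: "cmod (F i w) \<le> r ^ n * (cmod (c i) * r ^ i) * G w" for i w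
  proof (cases "w \<in> ball 0 r")
    case True
    then have "cmod w ^ n \<le> r ^ n" "cmod w ^ i \<le> r ^ i"
      by (auto intro!: power_mono)
    then have "cmod w powr (2 * \<nu> - 2) * (cmod w ^ n * (cmod (c i) * cmod w ^ i)) \<le>
        cmod w powr (2 * \<nu> - 2) * (r ^ n * (cmod (c i) * r ^ i))"
      using r by (intro mult_left_mono mult_mono) auto
    with True show ?thesis by (simp add: F_def G_def norm_mult norm_power mult_ac)
  qed (simp add: F_def G_def)
  have int: "integrable lborel (F i)" for i
    by (rule Bochner_Integration.integrable_bound[of _ "\<lambda>w. r ^ n * (cmod (c i) * r ^ i) * G w"])
      (use G bound[of i] in \<open>auto intro!: AE_I2 order_trans[OF bound] simp del: power_Suc\<close>)
  have summ: "summable (\<lambda>i. cmod (c i) * r ^ i)"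
    unfolding c_def using r by (intro taylor_coeff_abs_summable[OF h]) auto
  have pw: "(\<lambda>i. F i w) sums (indicator (ball 0 r) w *\<^sub>R (of_real (cmod w powr (2 * \<nu> - 2)) * (cnj w ^ n * h w)))"
    for w
  proof (cases "w \<in> ball 0 r")
    case True
    then have "(\<lambda>i. c i * w ^ i) sums h w"
      unfolding c_def using r by (intro taylor_coeff_sums[OF h]) auto
    then show ?thesis using True
      unfolding F_def by (intro sums_scaleR_right sums_mult)
  qed (simp add: F_def)
  have "?L = (LINT w|lborel. (\<Sum>i. F i w))"
    using pw by (simp add: set_lebesgue_integral_def sums_iff)
  also have "\<dots> = (\<Sum>i. LINT w|lborel. F i w)"
  proof (rule integral_suminf[OF int])
    show "AE w in lborel. summable (\<lambda>i. norm (F i w))"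
    proof (rule AE_I2)
      fix w
      have "summable (\<lambda>i. r ^ n * (cmod (c i) * r ^ i) * G w)"
        using summ by (intro summable_mult summable_mult2)
      then show "summable (\<lambda>i. norm (F i w))"
        by (rule summable_comparison_test') (use bound in auto)
    qed
    have "summable (\<lambda>i. r ^ n * (cmod (c i) * r ^ i) * (LINT w|lborel. G w))"
      using summ by (intro summable_mult summable_mult2)
    then show "summable (\<lambda>i. LINT w|lborel. norm (F i w))"
    proof (rule summable_comparison_test'[of _ 0])
      fix i
      have "(LINT w|lborel. norm (F i w)) \<le> (LINT w|lborel. r ^ n * (cmod (c i) * r ^ i) * G w)"
        by (intro integral_mono integrable_norm int integrable_mult_right G bound)
      then show "norm (LINT w|lborel. norm (F i w)) \<le> r ^ n * (cmod (c i) * r ^ i) * (LINT w|lborel. G w)"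
        by simp
    qed
  qed
  also have "(\<lambda>i. LINT w|lborel. F i w) = (\<lambda>i. if i = n then
      c n * of_real (pi * r powr (2 * (real n + \<nu>)) / (real n + \<nu>)) else 0)"
  proof
    fix i
    have "(LINT w|lborel. F i w) =
      (LINT w:ball 0 r|lborel. c i * (of_real (cmod w powr (2 * \<nu> - 2)) * (cnj w ^ n * w ^ i)))"
      unfolding F_def set_lebesgue_integral_def
      by (intro Bochner_Integration.integral_cong) (auto simp: mult_ac)
    also have "\<dots> = c i * (LINT w:ball 0 r|lborel. of_real (cmod w powr (2 * \<nu> - 2)) * (cnj w ^ n * w ^ i))"
      by (rule set_integral_mult_right)
    finally show "(LINT w|lborel. F i w) = (if i = n then
      c n * of_real (pi * r powr (2 * (real n + \<nu>)) / (real n + \<nu>)) else 0)"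
      using disc_orthogonality[of i n r "2 * \<nu> - 2"] disc_monomial_norm[OF r(1) \<nu>, of n] by auto
  qed
  also have "(\<Sum>i. if i = n then
      c n * of_real (pi * r powr (2 * (real n + \<nu>)) / (real n + \<nu>)) else 0) =
      c n * of_real (pi * r powr (2 * (real n + \<nu>)) / (real n + \<nu>))"
    by (subst suminf_finite[of "{n}"]) auto
  finally show ?thesis by (simp add: c_def)
qed

text \<open>
  The moments on the smaller discs exhaust the moment on the whole disc by dominated
  convergence.
\<close>

lemma holomorphic_moment:
  assumes h: "h holomorphic_on ball 0 R" and R: "R > 0" and \<nu>: "\<nu> > 0"
    and int: "set_integrable lborel (ball 0 R) (\<lambda>w. of_real (cmod w powr (2 * \<nu> - 2)) * h w)"
  shows "set_integrable lborel (ball 0 R) (\<lambda>w. of_real (cmod w powr (2 * \<nu> - 2)) * (cnj w ^ n * h w))"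
    and "(LINT w:ball 0 R|lborel. of_real (cmod w powr (2 * \<nu> - 2)) * (cnj w ^ n * h w)) =
    taylor_coeff h n * of_real (pi * R powr (2 * (real n + \<nu>)) / (real n + \<nu>))"
proof -
  define g where "g w = of_real (cmod w powr (2 * \<nu> - 2)) * (cnj w ^ n * h w)" for w
  define r where "r j = R * (1 - 1 / (real j + 2))" for j
  define D where "D w = R ^ n * cmod (indicator (ball 0 R) w *\<^sub>R (of_real (cmod w powr (2 * \<nu> - 2)) * h w))" for w
  have r: "0 < r j" "r j < R" for j
    using R by (auto simp: r_def field_simps intro: add_pos_nonneg)
  have rlim: "r \<longlonglongrightarrow> R"
    unfolding r_def by real_asymp
  have D: "integrable lborel D"
    using int unfolding D_def set_integrable_def by (intro integrable_mult_right integrable_norm)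
  have bound: "cmod (indicator (ball 0 R) w *\<^sub>R g w) \<le> D w" for w
  proof (cases "w \<in> ball 0 R")
    case True
    then have "cmod w ^ n \<le> R ^ n" by (auto intro!: power_mono)
    then have "cmod w ^ n * (cmod w powr (2 * \<nu> - 2) * cmod (h w)) \<le> R ^ n * (cmod w powr (2 * \<nu> - 2) * cmod (h w))"
      by (intro mult_right_mono) auto
    with True show ?thesis by (simp add: g_def D_def norm_mult norm_power mult_ac)
  qed (simp add: D_def R)
  have "(\<lambda>w. indicator (ball 0 R) w *\<^sub>R h w) \<in> borel_measurable borel"
    by (rule borel_measurable_continuous_on_indicator) (auto intro: holomorphic_on_imp_continuous_on h)
  then have "(\<lambda>w. of_real (cmod w powr (2 * \<nu> - 2)) * cnj w ^ n * (indicator (ball 0 R) w *\<^sub>R h w)) \<in> borel_measurable borel"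
    by measurable
  then have gm: "(\<lambda>w. indicator (ball 0 R) w *\<^sub>R g w) \<in> borel_measurable borel"
    by (simp add: g_def mult_ac)
  show int': "set_integrable lborel (ball 0 R) g"
    unfolding set_integrable_def
    by (rule Bochner_Integration.integrable_bound[OF D]) (use gm in \<open>auto intro!: AE_I2 order_trans[OF bound] simp del: norm_scaleR\<close>)
  have "(\<lambda>j. LINT w:ball 0 (r j)|lborel. g w) \<longlonglongrightarrow> (LINT w:ball 0 R|lborel. g w)"
    unfolding set_lebesgue_integral_def
  proof (rule integral_dominated_convergence[OF _ _ D])
    show "AE w in lborel. (\<lambda>j. indicator (ball 0 (r j)) w *\<^sub>R g w) \<longlonglongrightarrow> indicator (ball 0 R) w *\<^sub>R g w"
    proof (rule AE_I2)
      fix w :: complex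
      have "\<forall>\<^sub>F j in sequentially. indicator (ball 0 (r j)) w *\<^sub>R g w = indicator (ball 0 R) w *\<^sub>R g w"
      proof (cases "cmod w < R")
        case True
        then have "\<forall>\<^sub>F j in sequentially. cmod w < r j"
          using rlim by (rule order_tendstoD(1)[rotated])
        then show ?thesis by eventually_elim (use True in auto)
      next
        case False
        then have "\<not> cmod w < r j" for j using r(2)[of j] by linarith
        with False show ?thesis by simp
      qed
      then show "(\<lambda>j. indicator (ball 0 (r j)) w *\<^sub>R g w) \<longlonglongrightarrow> indicator (ball 0 R) w *\<^sub>R g w"
        by (rule tendsto_eventually)
    qed
    have sub: "indicator (ball 0 (r j)) w *\<^sub>R g w = indicator (ball 0 (r j)) w *\<^sub>R (indicator (ball 0 R) w *\<^sub>R g w)" for j w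
      using r(2)[of j] by (auto simp: indicator_def)
    show "AE w in lborel. cmod (indicator (ball 0 (r j)) w *\<^sub>R g w) \<le> D w" for j
    proof (rule AE_I2)
      fix w
      have "cmod (indicator (ball 0 (r j)) w *\<^sub>R g w) \<le> cmod (indicator (ball 0 R) w *\<^sub>R g w)"
        using r(2)[of j] by (auto simp: indicator_def)
      with bound[of w] show "cmod (indicator (ball 0 (r j)) w *\<^sub>R g w) \<le> D w" by linarith
    qed
    show "(\<lambda>w. indicator (ball 0 (r j)) w *\<^sub>R g w) \<in> borel_measurable lborel" for j
      unfolding sub using gm by measurable
  qed (use gm in simp)
  moreover have "(\<lambda>j. LINT w:ball 0 (r j)|lborel. g w) \<longlonglongrightarrow>
      taylor_coeff h n * of_real (pi * R powr (2 * (real n + \<nu>)) / (real n + \<nu>))"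
    unfolding g_def holomorphic_moment_smaller_disc[OF h r \<nu>]
    using R \<nu> by (intro tendsto_intros rlim) auto
  ultimately show "(LINT w:ball 0 R|lborel. g w) =
      taylor_coeff h n * of_real (pi * R powr (2 * (real n + \<nu>)) / (real n + \<nu>))"
    using LIMSEQ_unique by blast
qed
lemma cmod_power_mult_cnj: "cnj w ^ n * w ^ n = complex_of_real (cmod w ^ (2 * n))"
proof -
  have "cnj w ^ n * w ^ n = (w * cnj w) ^ n"
    by (simp add: power_mult_distrib mult.commute)
  also have "\<dots> = complex_of_real ((cmod w)\<^sup>2) ^ n"
    unfolding complex_norm_square ..
  finally show ?thesis by (simp add: power_mult)
qed

lemma set_integrable_if_square_integrable:
  fixes f :: "'a::euclidean_space \<Rightarrow> complex"
  assumes "A \<in> sets borel" "emeasure lborel A < \<infinity>" "continuous_on A f"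
    and "set_integrable lborel A (\<lambda>x. (cmod (f x))\<^sup>2)"
  shows "set_integrable lborel A f"
proof -
  have "integrable lborel (\<lambda>x. indicator A x + indicator A x *\<^sub>R (cmod (f x))\<^sup>2 :: real)"
    using assms by (intro Bochner_Integration.integrable_add) (auto simp: set_integrable_def)
  moreover have "(\<lambda>x. indicator A x *\<^sub>R f x) \<in> borel_measurable borel"
    using assms(1,3) by (rule borel_measurable_continuous_on_indicator)
  moreover have "cmod (f x) \<le> 1 + (cmod (f x))\<^sup>2" for x
    using sum_squares_bound[of "cmod (f x)" 1] by (simp add: power2_eq_square) (smt (verit) norm_ge_zero)
  ultimately show ?thesis
    unfolding set_integrable_def
    by (elim Bochner_Integration.integrable_bound) (auto simp: indicator_def)
qed

lemma powr_double_Suc: "R > 0 \<Longrightarrow> R powr (2 * (real n + 1)) = R ^ (2 * n + 2)"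
  using powr_realpow[of R "2 * n + 2"] by (simp add: algebra_simps)

text \<open>
  The case \<open>\<nu> = 1\<close> of the preceding moments. The weight \<open>cmod w powr 0\<close> is \<open>0\<close>
  rather than \<open>1\<close> at the origin, hence the detour through equality almost everywhere.
\<close>

lemma
  assumes h: "h holomorphic_on ball 0 R" and R: "R > 0"
    and int: "set_integrable lborel (ball 0 R) h"
  shows integrable_moment_unweighted: "set_integrable lborel (ball 0 R) (\<lambda>w. cnj w ^ n * h w)"
    and integral_moment_unweighted: "(LINT w:ball 0 R|lborel. cnj w ^ n * h w) =
      taylor_coeff h n * of_real (pi * R ^ (2 * n + 2) / (real n + 1))"
proof -
  have ae: "AE w::complex in lborel. complex_of_real (cmod w powr (2 * 1 - 2)) = 1"
    using AE_lborel_singleton[of "0::complex"] by eventually_elim simp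
  have [measurable]: "(\<lambda>w. indicator (ball 0 R) w *\<^sub>R h w) \<in> borel_measurable lborel"
    using int unfolding set_integrable_def by (rule borel_measurable_integrable)
  then have "(\<lambda>w. cnj w ^ n * (indicator (ball 0 R) w *\<^sub>R h w)) \<in> borel_measurable lborel"
    by measurable
  then have m1 [measurable]: "(\<lambda>w. indicator (ball 0 R) w *\<^sub>R (cnj w ^ n * h w)) \<in> borel_measurable lborel"
    by simp
  have "(\<lambda>w. complex_of_real (cmod w powr (2 * 1 - 2)) * (indicator (ball 0 R) w *\<^sub>R h w)) \<in> borel_measurable lborel"
    by measurable
  then have m2: "(\<lambda>w. indicator (ball 0 R) w *\<^sub>R (complex_of_real (cmod w powr (2 * 1 - 2)) * h w)) \<in> borel_measurable lborel"
    by (simp only: scaleR_conv_of_real mult.left_commute)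
  have "(\<lambda>w. complex_of_real (cmod w powr (2 * 1 - 2)) * (indicator (ball 0 R) w *\<^sub>R (cnj w ^ n * h w))) \<in> borel_measurable lborel"
    by measurable
  then have m3: "(\<lambda>w. indicator (ball 0 R) w *\<^sub>R (complex_of_real (cmod w powr (2 * 1 - 2)) * (cnj w ^ n * h w))) \<in> borel_measurable lborel"
    by (simp only: scaleR_conv_of_real mult.left_commute)
  have "set_integrable lborel (ball 0 R) (\<lambda>w. of_real (cmod w powr (2 * 1 - 2)) * h w)"
    using int unfolding set_integrable_def
  proof (rule integrable_cong_AE_imp[OF _ m2])
    show "AE w in lborel. indicator (ball 0 R) w *\<^sub>R h w =
        indicator (ball 0 R) w *\<^sub>R (complex_of_real (cmod w powr (2 * 1 - 2)) * h w)"
      using ae by eventually_elim simp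
  qed
  note mom = holomorphic_moment[OF h R zero_less_one this, of n]
  show "set_integrable lborel (ball 0 R) (\<lambda>w. cnj w ^ n * h w)"
    using mom(1) unfolding set_integrable_def
  proof (rule integrable_cong_AE_imp[OF _ m1])
    show "AE w in lborel. indicator (ball 0 R) w *\<^sub>R (complex_of_real (cmod w powr (2 * 1 - 2)) * (cnj w ^ n * h w)) =
        indicator (ball 0 R) w *\<^sub>R (cnj w ^ n * h w)"
      using ae by eventually_elim simp
  qed
  have "(LINT w:ball 0 R|lborel. cnj w ^ n * h w) =
      (LINT w:ball 0 R|lborel. of_real (cmod w powr (2 * 1 - 2)) * (cnj w ^ n * h w))"
    unfolding set_lebesgue_integral_def
  proof (rule integral_cong_AE[OF m1 m3])
    show "AE w in lborel. indicator (ball 0 R) w *\<^sub>R (cnj w ^ n * h w) =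
        indicator (ball 0 R) w *\<^sub>R (complex_of_real (cmod w powr (2 * 1 - 2)) * (cnj w ^ n * h w))"
      using ae by eventually_elim simp
  qed
  also have "R powr (2 * (real n + 1)) = R ^ (2 * n + 2)"
    using R by (rule powr_double_Suc)
  then have "(LINT w:ball 0 R|lborel. of_real (cmod w powr (2 * 1 - 2)) * (cnj w ^ n * h w)) =
      taylor_coeff h n * of_real (pi * R ^ (2 * n + 2) / (real n + 1))"
    using mom(2) by presburger
  finally show "(LINT w:ball 0 R|lborel. cnj w ^ n * h w) =
      taylor_coeff h n * of_real (pi * R ^ (2 * n + 2) / (real n + 1))" .
qed

text \<open>
  Bessel's inequality for the single monomial \<open>w ^ n\<close>: integrate
  \<open>0 \<le> (cmod (h w - c * w ^ n))\<^sup>2\<close>, where \<open>c\<close> is the Taylor coefficient.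
\<close>

lemma bessel_disc:
  assumes h: "h holomorphic_on ball 0 R" and R: "R > 0"
    and int: "set_integrable lborel (ball 0 R) (\<lambda>w. (cmod (h w))\<^sup>2)"
  shows "(cmod (taylor_coeff h n))\<^sup>2 * (pi * R ^ (2 * n + 2) / (real n + 1)) \<le>
    (LINT w:ball 0 R|lborel. (cmod (h w))\<^sup>2)"
proof -
  define c where "c = taylor_coeff h n"
  define N where "N = pi * R ^ (2 * n + 2) / (real n + 1)"
  have fin: "emeasure lborel (ball (0::complex) R) < \<infinity>"
    by (rule emeasure_lborel_ball_finite)
  have inth: "set_integrable lborel (ball 0 R) h"
    by (rule set_integrable_if_square_integrable[OF _ fin _ int])
       (auto intro: holomorphic_on_imp_continuous_on h)
  have 1: "set_integrable lborel (ball 0 R) (\<lambda>w. cnj c * (cnj w ^ n * h w))"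
    using integrable_moment_unweighted[OF h R inth] by simp
  have v1: "(LINT w:ball 0 R|lborel. cnj c * (cnj w ^ n * h w)) = of_real ((cmod c)\<^sup>2 * N)"
    unfolding set_integral_mult_right integral_moment_unweighted[OF h R inth] complex_norm_square of_real_mult
    by (simp add: c_def N_def mult.commute)
  have 2: "set_integrable lborel (ball 0 R) (\<lambda>w::complex. (cmod c)\<^sup>2 * cmod w ^ (2 * n))"
    and v2: "(LINT w:ball (0::complex) R|lborel. (cmod c)\<^sup>2 * cmod w ^ (2 * n)) = (cmod c)\<^sup>2 * N"
  proof -
    have eq: "AE w::complex in lborel. cmod w ^ (2 * n) = cmod w powr (2 * (real n + 1) - 2)"
      using AE_lborel_singleton[of "0::complex"]
    proof eventually_elim
      case (elim w)
      then have "cmod w powr real (2 * n) = cmod w ^ (2 * n)" by (intro powr_realpow) simp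
      then show ?case by (simp add: algebra_simps)
    qed
    have "set_integrable lborel (ball 0 R) (\<lambda>w::complex. cmod w ^ (2 * n))"
      unfolding set_integrable_def
      by (rule integrable_cong_AE_imp[OF set_integrable_cmod_powr_disc[OF R, of "real n + 1",
            unfolded set_integrable_def]]) (use eq in \<open>auto elim!: eventually_mono\<close>)
    then show "set_integrable lborel (ball 0 R) (\<lambda>w::complex. (cmod c)\<^sup>2 * cmod w ^ (2 * n))"
      by simp
    have "(LINT w:ball (0::complex) R|lborel. cmod w ^ (2 * n)) =
        (LINT w:ball (0::complex) R|lborel. cmod w powr (2 * (real n + 1) - 2))"
      unfolding set_lebesgue_integral_def
      by (rule integral_cong_AE) (use eq in \<open>auto elim!: eventually_mono\<close>)
    also have "\<dots> = pi * R powr (2 * (real n + 1)) / (real n + 1)"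
      by (rule integral_cmod_powr_disc[OF R]) simp
    also have "R powr (2 * (real n + 1)) = R ^ (2 * n + 2)"
      using R by (rule powr_double_Suc)
    finally show "(LINT w:ball (0::complex) R|lborel. (cmod c)\<^sup>2 * cmod w ^ (2 * n)) = (cmod c)\<^sup>2 * N"
      by (simp add: N_def)
  qed
  have re: "set_integrable lborel (ball 0 R) (\<lambda>w. Re (cnj c * (cnj w ^ n * h w)))"
    and vre: "(LINT w:ball 0 R|lborel. Re (cnj c * (cnj w ^ n * h w))) = (cmod c)\<^sup>2 * N"
  proof -
    have eq: "indicator (ball 0 R) w *\<^sub>R Re (cnj c * (cnj w ^ n * h w)) =
        Re (indicator (ball 0 R) w *\<^sub>R (cnj c * (cnj w ^ n * h w)))" for w
      by simp
    show "set_integrable lborel (ball 0 R) (\<lambda>w. Re (cnj c * (cnj w ^ n * h w)))"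
      unfolding set_integrable_def eq using 1 unfolding set_integrable_def by (rule integrable_Re)
    have "(LINT w:ball 0 R|lborel. Re (cnj c * (cnj w ^ n * h w))) =
        Re (LINT w:ball 0 R|lborel. cnj c * (cnj w ^ n * h w))"
      unfolding set_lebesgue_integral_def eq using 1 unfolding set_integrable_def by (rule integral_Re)
    then show "(LINT w:ball 0 R|lborel. Re (cnj c * (cnj w ^ n * h w))) = (cmod c)\<^sup>2 * N"
      by (simp only: v1 Re_complex_of_real)
  qed
  have pw: "2 * Re (cnj c * (cnj w ^ n * h w)) - (cmod c)\<^sup>2 * cmod w ^ (2 * n) \<le> (cmod (h w))\<^sup>2" for w
  proof -
    define a where "a = c * w ^ n"
    have "0 \<le> (cmod (h w - a))\<^sup>2" by simp
    also have "\<dots> = (cmod (h w))\<^sup>2 - 2 * Re (cnj a * h w) + (cmod a)\<^sup>2"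
      unfolding cmod_power2 by (simp add: power2_eq_square algebra_simps)
    also have "cnj a * h w = cnj c * (cnj w ^ n * h w)"
      by (simp add: a_def)
    also have "(cmod a)\<^sup>2 = (cmod c)\<^sup>2 * cmod w ^ (2 * n)"
      by (simp add: a_def norm_mult norm_power power_mult_distrib flip: power_mult) (simp add: mult.commute)
    finally show ?thesis by linarith
  qed
  have "2 * ((cmod c)\<^sup>2 * N) - (cmod c)\<^sup>2 * N =
      (LINT w:ball 0 R|lborel. 2 * Re (cnj c * (cnj w ^ n * h w)) - (cmod c)\<^sup>2 * cmod w ^ (2 * n))"
    using re vre 2 v2 by (subst set_integral_diff) (auto simp del: times_complex.sel)
  also have "\<dots> \<le> (LINT w:ball 0 R|lborel. (cmod (h w))\<^sup>2)"
    using pw re 2 int by (intro set_integral_mono set_integral_diff) (auto simp del: times_complex.sel)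
  finally show ?thesis by (simp add: c_def N_def mult_ac)
qed

section \<open>Square-integrable isolated singularities\<close>

text \<open>
  Bessel's inequality for the constant term on the disc of radius \<open>cmod a\<close> about \<open>a\<close>
  bounds \<open>(cmod (a * h a))\<^sup>2\<close> by the energy of \<open>h\<close> near \<open>0\<close>, which vanishes in
  the limit. So \<open>a * h a\<close> tends to \<open>0\<close>, and Riemann's theorem applies.
\<close>

lemma square_integrable_removable:
  assumes h: "h holomorphic_on ball 0 1 - {0}"
    and int: "set_integrable lborel (ball 0 1 - {0}) (\<lambda>w. (cmod (h w))\<^sup>2)"
  shows "\<exists>g. g holomorphic_on ball 0 1 \<and> (\<forall>w\<in>ball 0 1 - {0}. g w = h w)"
proof -
  define F where "F w = indicator (ball 0 1 - {0}) w *\<^sub>R (cmod (h w))\<^sup>2" for w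
  have F: "integrable lborel F" using int by (simp add: F_def [abs_def] set_integrable_def)
  have F_nonneg: "F w \<ge> 0" for w by (simp add: F_def)
  define \<Phi> where "\<Phi> a = (LINT w|lborel. indicator (ball 0 (2 * cmod a)) w *\<^sub>R F w)" for a :: complex
  have le: "(cmod (a * h a))\<^sup>2 * pi \<le> \<Phi> a" if a: "a \<noteq> 0" "cmod a < 1 / 2" for a
  proof -
    define H where "H w = h (a + w)" for w
    have sub: "ball a (cmod a) \<subseteq> ball 0 1 - {0}"
    proof
      fix w assume w: "w \<in> ball a (cmod a)"
      then have "cmod w < 1"
        using norm_triangle_sub[of w a] a by (auto simp: dist_norm norm_minus_commute)
      then show "w \<in> ball 0 1 - {0}" using w by auto
    qed
    have "H holomorphic_on ball 0 (cmod a)"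
      unfolding H_def
    proof (rule holomorphic_on_compose_gen[unfolded o_def, of "\<lambda>w. a + w" _ h "ball 0 1 - {0}"])
      show "(+) a ` ball 0 (cmod a) \<subseteq> ball 0 1 - {0}"
        using sub by (simp add: image_add_ball)
    qed (auto intro!: holomorphic_intros h)
    have eq: "indicator (ball 0 (cmod a)) w *\<^sub>R (cmod (H w))\<^sup>2 =
        indicator (ball a (cmod a)) (a + w) *\<^sub>R F (a + w)" for w
    proof (cases "w \<in> ball 0 (cmod a)")
      case True
      then have "a + w \<in> ball a (cmod a)" by (simp add: dist_norm)
      with sub have "a + w \<in> ball 0 1 - {0}" by blast
      with True \<open>a + w \<in> ball a (cmod a)\<close> show ?thesis by (simp add: F_def H_def del: mem_ball)
    next
      case False
      then have "a + w \<notin> ball a (cmod a)" by (simp add: dist_norm)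
      with False show ?thesis by simp
    qed
    have iF: "integrable lborel (\<lambda>w. indicator (ball a (cmod a)) w *\<^sub>R F w)"
      by (rule integrable_mult_indicator) (use F in auto)
    have "integrable (distr lborel borel ((+) a)) (\<lambda>w. indicator (ball a (cmod a)) w *\<^sub>R F w)"
      using iF by (simp add: lborel_distr_plus)
    then have iH: "set_integrable lborel (ball 0 (cmod a)) (\<lambda>w. (cmod (H w))\<^sup>2)"
      unfolding set_integrable_def eq using iF by (subst (asm) integrable_distr_eq) auto
    have "(cmod (taylor_coeff H 0))\<^sup>2 * (pi * cmod a ^ (2 * 0 + 2) / (real 0 + 1)) \<le>
        (LINT w:ball 0 (cmod a)|lborel. (cmod (H w))\<^sup>2)"
      by (rule bessel_disc) (use a iH \<open>H holomorphic_on _\<close> in auto)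
    also have "\<dots> = (LINT w|distr lborel borel ((+) a). indicator (ball a (cmod a)) w *\<^sub>R F w)"
      unfolding set_lebesgue_integral_def eq using iF by (subst integral_distr) auto
    also have "\<dots> = (LINT w|lborel. indicator (ball a (cmod a)) w *\<^sub>R F w)"
      by (simp add: lborel_distr_plus)
    also have "\<dots> \<le> \<Phi> a"
      unfolding \<Phi>_def
    proof (rule integral_mono[OF iF])
      show "integrable lborel (\<lambda>w. indicator (ball 0 (2 * cmod a)) w *\<^sub>R F w)"
        by (rule integrable_mult_indicator) (use F in auto)
      fix w :: complex
      have "w \<in> ball 0 (2 * cmod a)" if "w \<in> ball a (cmod a)"
        using that norm_triangle_sub[of w a] by (auto simp: dist_norm norm_minus_commute)
      then show "indicator (ball a (cmod a)) w *\<^sub>R F w \<le> indicator (ball 0 (2 * cmod a)) w *\<^sub>R F w"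
        using F_nonneg[of w] by (auto simp: indicator_def)
    qed
    finally show ?thesis
      by (simp add: H_def taylor_coeff_def norm_mult power_mult_distrib power2_eq_square mult_ac)
  qed
  have "(\<Phi> \<longlongrightarrow> 0) (at 0)"
  proof (subst tendsto_at_iff_sequentially, intro allI impI)
    fix X :: "nat \<Rightarrow> complex" assume X: "\<forall>i. X i \<in> UNIV - {0}" "X \<longlonglongrightarrow> 0"
    have "(\<lambda>i. LINT w|lborel. indicator (ball 0 (2 * cmod (X i))) w *\<^sub>R F w) \<longlonglongrightarrow> (LINT w::complex|lborel. 0)"
    proof (rule integral_dominated_convergence[OF _ _ F])
      show "AE w in lborel. (\<lambda>i. indicator (ball 0 (2 * cmod (X i))) w *\<^sub>R F w) \<longlonglongrightarrow> 0"
        using AE_lborel_singleton[of "0::complex"]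
      proof eventually_elim
        case (elim w)
        have "(\<lambda>i. 2 * cmod (X i)) \<longlonglongrightarrow> 2 * cmod 0"
          by (intro tendsto_intros X(2))
        then have "\<forall>\<^sub>F i in sequentially. 2 * cmod (X i) < cmod w"
          by (rule order_tendstoD) (use elim in simp)
        then have "\<forall>\<^sub>F i in sequentially. indicator (ball 0 (2 * cmod (X i))) w *\<^sub>R F w = 0"
          by eventually_elim auto
        then show ?case by (rule tendsto_eventually)
      qed
      show "AE w in lborel. norm (indicator (ball 0 (2 * cmod (X i))) w *\<^sub>R F w) \<le> F w" for i
        using F_nonneg by (auto simp: indicator_def)
      show "(\<lambda>w. indicator (ball 0 (2 * cmod (X i))) w *\<^sub>R F w) \<in> borel_measurable lborel" for i
        using F by measurable
    qed auto
    then show "(\<Phi> \<circ> X) \<longlonglongrightarrow> 0" by (simp add: \<Phi>_def o_def)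
  qed
  then have "((\<lambda>a. sqrt (\<Phi> a / pi)) \<longlongrightarrow> sqrt (0 / pi)) (at 0)"
    by (intro tendsto_intros) auto
  then have lim: "((\<lambda>a. sqrt (\<Phi> a / pi)) \<longlongrightarrow> 0) (at 0)" by simp
  have "((\<lambda>a. a * h a) \<longlongrightarrow> 0) (at 0)"
  proof (rule tendsto_norm_zero_cancel, rule tendsto_sandwich[OF _ _ tendsto_const lim])
    have "\<forall>\<^sub>F a in at 0. a \<in> ball (0::complex) (1 / 2) - {0}"
      by (rule eventually_at_in_open) auto
    then show "\<forall>\<^sub>F a in at 0. cmod (a * h a) \<le> sqrt (\<Phi> a / pi)"
    proof eventually_elim
      case (elim a)
      then show ?case
        using le[of a] by (intro real_le_rsqrt) (auto simp: field_simps)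
    qed
  qed simp
  then show ?thesis
    using holomorphic_on_extend_lim[OF h] by simp
qed

section \<open>Weighted Bergman kernels of the disc\<close>

lemma weighted_geometric_sums:
  fixes x :: complex
  assumes "cmod x < 1"
  shows "(\<lambda>n. of_real (real n + \<nu>) * x ^ n) sums ((of_real \<nu> + (1 - of_real \<nu>) * x) / (1 - x)\<^sup>2)"
proof -
  have "1 - x \<noteq> 0" using assms by auto
  then have eq: "1 / (1 - x)\<^sup>2 + (of_real \<nu> - 1) * (1 / (1 - x)) = (of_real \<nu> + (1 - of_real \<nu>) * x) / (1 - x)\<^sup>2"
    by (simp add: divide_simps) (simp add: power2_eq_square algebra_simps)
  have "(\<lambda>n. of_nat (Suc n) * x ^ n + (of_real \<nu> - 1) * x ^ n) sums
      (1 / (1 - x)\<^sup>2 + (of_real \<nu> - 1) * (1 / (1 - x)))"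
    using assms by (intro sums_add sums_mult geometric_sums geometric_deriv_sums)
  then show ?thesis unfolding eq by (simp add: algebra_simps)
qed

text \<open>
  The monomials \<open>w ^ n\<close> are orthogonal for the weight \<open>cmod w powr (2 * \<nu> - 2)\<close>,
  with squared norms \<open>\<pi> / (n + \<nu>)\<close>. So \<open>\<pi>\<close> times the weighted Bergman kernel is
  the sum of \<open>(n + \<nu>) * (z * cnj w) ^ n\<close>, and its closed form is the fraction below.
\<close>

lemma weighted_disc_reproducing:
  assumes h: "h holomorphic_on ball 0 1" and \<nu>: "\<nu> > 0" and z: "cmod z < 1"
    and int: "set_integrable lborel (ball 0 1) (\<lambda>w. of_real (cmod w powr (2 * \<nu> - 2)) * h w)"
  shows "(LINT w:ball 0 1|lborel. of_real (cmod w powr (2 * \<nu> - 2)) *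
      ((of_real \<nu> + (1 - of_real \<nu>) * (z * cnj w)) / (1 - z * cnj w)\<^sup>2 * h w)) = of_real pi * h z"
proof -
  define c where "c = (\<lambda>n. of_real (real n + \<nu>) * z ^ n)"
  define g where "g w = of_real (cmod w powr (2 * \<nu> - 2)) * h w" for w
  define G where "G w = cmod (indicator (ball 0 1) w *\<^sub>R g w)" for w
  define F where "F n w = c n * (indicator (ball 0 1) w *\<^sub>R (of_real (cmod w powr (2 * \<nu> - 2)) * (cnj w ^ n * h w)))" for n w
  have G: "integrable lborel G"
    using int unfolding G_def g_def set_integrable_def by (rule integrable_norm)
  have intF: "integrable lborel (F n)" for n
    unfolding F_def using holomorphic_moment(1)[OF h zero_less_one \<nu> int, of n]
    unfolding set_integrable_def by (rule integrable_mult_right)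
  have summ: "summable (\<lambda>n. cmod (c n))"
  proof -
    have "(\<lambda>n. (real n + \<nu>) * cmod z ^ n) = (\<lambda>n. real (Suc n) * cmod z ^ n + (\<nu> - 1) * cmod z ^ n)"
      by (auto simp: algebra_simps)
    moreover have "summable (\<lambda>n. real (Suc n) * cmod z ^ n + (\<nu> - 1) * cmod z ^ n)"
      using z by (intro summable_add summable_mult summable_geometric sums_summable[OF geometric_deriv_sums]) auto
    moreover have "cmod (c n) = (real n + \<nu>) * cmod z ^ n" for n
      using \<nu> by (simp add: c_def norm_mult norm_power del: of_real_add)
    ultimately show ?thesis by simp
  qed
  have bound: "cmod (F n w) \<le> cmod (c n) * G w" for n w
  proof (cases "w \<in> ball 0 1")
    case True
    then have "cmod w ^ n \<le> 1" by (simp add: power_le_one)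
    then have "cmod w ^ n * (cmod w powr (2 * \<nu> - 2) * cmod (h w)) \<le> 1 * (cmod w powr (2 * \<nu> - 2) * cmod (h w))"
      by (intro mult_right_mono) auto
    then have "cmod (c n) * (cmod w ^ n * (cmod w powr (2 * \<nu> - 2) * cmod (h w))) \<le>
        cmod (c n) * (cmod w powr (2 * \<nu> - 2) * cmod (h w))"
      by (intro mult_left_mono) auto
    with True show ?thesis by (simp add: F_def G_def g_def norm_mult norm_power mult_ac)
  qed (simp add: F_def G_def)
  have pw: "(\<lambda>n. F n w) sums (indicator (ball 0 1) w *\<^sub>R (of_real (cmod w powr (2 * \<nu> - 2)) *
      ((of_real \<nu> + (1 - of_real \<nu>) * (z * cnj w)) / (1 - z * cnj w)\<^sup>2 * h w)))" for w
  proof (cases "w \<in> ball 0 1")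
    case True
    then have "cmod z * cmod w < 1 * 1"
      using z by (intro mult_strict_mono') auto
    then have "cmod (z * cnj w) < 1"
      by (simp add: norm_mult)
    from sums_mult2[OF weighted_geometric_sums[OF this, of \<nu>], of "of_real (cmod w powr (2 * \<nu> - 2)) * h w"]
    show ?thesis using True by (simp add: F_def c_def power_mult_distrib mult_ac)
  qed (simp add: F_def)
  have "(LINT w:ball 0 1|lborel. of_real (cmod w powr (2 * \<nu> - 2)) *
      ((of_real \<nu> + (1 - of_real \<nu>) * (z * cnj w)) / (1 - z * cnj w)\<^sup>2 * h w)) = (LINT w|lborel. (\<Sum>n. F n w))"
    using pw by (simp add: set_lebesgue_integral_def sums_iff)
  also have "\<dots> = (\<Sum>n. LINT w|lborel. F n w)"
  proof (rule integral_suminf[OF intF])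
    show "AE w in lborel. summable (\<lambda>n. norm (F n w))"
    proof (rule AE_I2)
      fix w
      have "summable (\<lambda>n. cmod (c n) * G w)"
        using summ by (intro summable_mult2)
      then show "summable (\<lambda>n. norm (F n w))"
        by (rule summable_comparison_test') (use bound in auto)
    qed
    have "summable (\<lambda>n. cmod (c n) * (LINT w|lborel. G w))"
      using summ by (intro summable_mult2)
    then show "summable (\<lambda>n. LINT w|lborel. norm (F n w))"
    proof (rule summable_comparison_test'[of _ 0])
      fix n
      have "(LINT w|lborel. norm (F n w)) \<le> (LINT w|lborel. cmod (c n) * G w)"
        by (intro integral_mono integrable_norm intF integrable_mult_right G bound)
      then show "norm (LINT w|lborel. norm (F n w)) \<le> cmod (c n) * (LINT w|lborel. G w)"
        by simp
    qed
  qed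
  also have "(\<lambda>n. LINT w|lborel. F n w) = (\<lambda>n. of_real pi * (taylor_coeff h n * z ^ n))"
  proof
    fix n
    have "(LINT w|lborel. F n w) = c n * (LINT w:ball 0 1|lborel. of_real (cmod w powr (2 * \<nu> - 2)) * (cnj w ^ n * h w))"
      unfolding F_def set_lebesgue_integral_def by (rule integral_mult_right_zero)
    also have "\<dots> = c n * (taylor_coeff h n * of_real (pi / (real n + \<nu>)))"
      using holomorphic_moment(2)[OF h zero_less_one \<nu> int, of n] by simp
    also have "\<dots> = of_real pi * (taylor_coeff h n * z ^ n)"
    proof -
      have "complex_of_real (real n + \<nu>) \<noteq> 0" using \<nu> by (subst of_real_eq_0_iff) linarith
      then show ?thesis by (simp add: c_def field_simps del: of_real_add)
    qed
    finally show "(LINT w|lborel. F n w) = of_real pi * (taylor_coeff h n * z ^ n)" .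
  qed
  also have "(\<Sum>n. of_real pi * (taylor_coeff h n * z ^ n)) = of_real pi * h z"
    using taylor_coeff_sums[OF h z] by (intro sums_unique[symmetric] sums_mult)
  finally show ?thesis .
qed

section \<open>Taylor coefficients that depend on a parameter\<close>
text \<open>
  Strong induction on \<open>n\<close>: after subtracting the lower Taylor terms and dividing by
  \<open>a ^ n\<close>, what remains tends to the \<open>n\<close>-th coefficient as \<open>a\<close> tends to \<open>0\<close>. Cauchy's
  estimates make the convergence uniform in \<open>b\<close>, and uniform limits of holomorphic functions
  are holomorphic.
\<close>

lemma holomorphic_taylor_coeff_parameter:
  fixes F :: "complex \<Rightarrow> complex \<Rightarrow> complex"
  assumes r: "r > 0"
    and cont: "continuous_on (cball 0 r \<times> cball b0 \<delta>) (\<lambda>(a, b). F a b)"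
    and hol1: "\<And>b. b \<in> cball b0 \<delta> \<Longrightarrow> (\<lambda>a. F a b) holomorphic_on ball 0 r"
    and hol2: "\<And>a. a \<in> ball 0 r \<Longrightarrow> F a holomorphic_on ball b0 \<delta>"
  shows "(\<lambda>b. taylor_coeff (\<lambda>a. F a b) n) holomorphic_on ball b0 \<delta>"
proof (induction n rule: less_induct)
  case (less n)
  define c where "c m b = taylor_coeff (\<lambda>a. F a b) m" for m b
  have "compact ((\<lambda>(a, b). F a b) ` (cball 0 r \<times> cball b0 \<delta>))"
    by (intro compact_continuous_image cont compact_Times compact_cball)
  then have "bounded ((\<lambda>(a, b). F a b) ` (cball 0 r \<times> cball b0 \<delta>))"
    by (rule compact_imp_bounded)
  then obtain M where M: "\<And>a b. a \<in> cball 0 r \<Longrightarrow> b \<in> cball b0 \<delta> \<Longrightarrow> cmod (F a b) \<le> M"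
    unfolding bounded_iff by fastforce
  have c_bound: "cmod (c m b) \<le> M / r ^ m" if b: "b \<in> cball b0 \<delta>" for m b
  proof -
    have "continuous_on (cball 0 r) ((\<lambda>(a, b). F a b) \<circ> (\<lambda>a. (a, b)))"
      by (intro continuous_on_compose continuous_intros continuous_on_subset[OF cont]) (use b in auto)
    then have "cmod ((deriv ^^ m) (\<lambda>a. F a b) 0) \<le> fact m * M / r ^ m"
      by (intro Cauchy_inequality hol1 b r M) (auto simp: o_def)
    then show ?thesis
      by (simp add: c_def taylor_coeff_def norm_divide field_simps)
  qed
  define x where "x j = 1 / (real j + 2)" for j
  have x: "0 < x j" "x j < 1" for j by (auto simp: x_def field_simps)
  define q where "q j b = (F (of_real (r * x j)) b - (\<Sum>m<n. c m b * of_real (r * x j) ^ m)) / of_real (r * x j) ^ n" for j b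
  have rx: "r * x j < r" for j using r x[of j] by simp
  have q_hol: "q j holomorphic_on ball b0 \<delta>" for j
  proof -
    have "F (of_real (r * x j)) holomorphic_on ball b0 \<delta>"
      by (rule hol2) (use r x[of j] rx[of j] in \<open>simp add: norm_mult\<close>)
    moreover have "of_real (r * x j) \<noteq> (0 :: complex)"
      using r x(1)[of j] by simp
    ultimately show ?thesis
      unfolding q_def c_def using less.IH by (intro holomorphic_intros) auto
  qed
  have q_bound: "cmod (q j b - c n b) \<le> M / r ^ n * (x j / (1 - x j))" if b: "b \<in> cball b0 \<delta>" for j b
  proof -
    define a where "a = complex_of_real (r * x j)"
    have a: "a \<noteq> 0" "cmod a < r" "cmod a = r * x j" using r x[of j] rx[of j] by (auto simp: a_def norm_mult)
    have "(\<lambda>m. c m b * a ^ m) sums F a b"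
      unfolding c_def by (rule taylor_coeff_sums[OF hol1[OF b] a(2)])
    then have "(\<lambda>i. c (i + Suc n) b * a ^ (i + Suc n)) sums (F a b - (\<Sum>m<Suc n. c m b * a ^ m))"
      by (rule sums_split_initial_segment)
    then have "(\<lambda>i. c (i + Suc n) b * a ^ (i + Suc n) / a ^ n) sums ((F a b - (\<Sum>m<Suc n. c m b * a ^ m)) / a ^ n)"
      by (rule sums_divide)
    moreover have "(F a b - (\<Sum>m<Suc n. c m b * a ^ m)) / a ^ n = q j b - c n b"
      using a by (simp add: q_def a_def field_simps)
    moreover have "c (i + Suc n) b * a ^ (i + Suc n) / a ^ n = c (i + Suc n) b * a ^ Suc i" for i
      using a by (simp add: power_add)
    ultimately have s: "(\<lambda>i. c (i + Suc n) b * a ^ Suc i) sums (q j b - c n b)"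
      by simp
    have g: "(\<lambda>i. M / r ^ n * (x j * x j ^ i)) sums (M / r ^ n * (x j * (1 / (1 - x j))))"
      using x[of j] by (intro sums_mult geometric_sums) auto
    have "cmod (\<Sum>i. c (i + Suc n) b * a ^ Suc i) \<le> (\<Sum>i. M / r ^ n * (x j * x j ^ i))"
    proof (rule norm_suminf_le)
      fix i
      have "cmod (c (i + Suc n) b * a ^ Suc i) \<le> M / r ^ (i + Suc n) * (r * x j) ^ Suc i"
        unfolding norm_mult norm_power a(3) using r x(1)[of j] by (intro mult_right_mono c_bound b) auto
      also have "\<dots> = M / r ^ n * (x j * x j ^ i)"
        using r by (simp add: power_add power_mult_distrib field_simps)
      finally show "cmod (c (i + Suc n) b * a ^ Suc i) \<le> M / r ^ n * (x j * x j ^ i)" .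
    qed (use g in \<open>simp add: sums_iff\<close>)
    then show ?thesis using s g by (simp add: sums_iff)
  qed
  have lim: "(\<lambda>j. M / r ^ n * (x j / (1 - x j))) \<longlonglongrightarrow> 0"
    unfolding x_def by real_asymp
  have unif: "uniform_limit (cball b0 \<delta>) q (c n) sequentially"
    unfolding uniform_limit_iff
  proof (intro allI impI)
    fix e :: real assume "e > 0"
    with lim have "\<forall>\<^sub>F j in sequentially. M / r ^ n * (x j / (1 - x j)) < e"
      by (rule order_tendstoD)
    then show "\<forall>\<^sub>F j in sequentially. \<forall>b\<in>cball b0 \<delta>. dist (q j b) (c n b) < e"
    proof eventually_elim
      case (elim j)
      then show ?case
        unfolding dist_norm using q_bound[of _ j] by (meson order_le_less_trans)
    qed
  qed
  have "c n holomorphic_on ball b0 \<delta>"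
  proof (rule holomorphic_uniform_sequence[OF open_ball q_hol])
    fix b assume "b \<in> ball b0 \<delta>"
    then obtain d where d: "d > 0" "cball b d \<subseteq> ball b0 \<delta>"
      using open_contains_cball[of "ball b0 \<delta>"] by (metis open_ball)
    moreover have "uniform_limit (cball b d) q (c n) sequentially"
      by (rule uniform_limit_on_subset[OF unif]) (use d in auto)
    ultimately show "\<exists>d>0. cball b d \<subseteq> ball b0 \<delta> \<and> uniform_limit (cball b d) q (c n) sequentially"
      by blast
  qed
  then show ?case unfolding c_def .
qed

section \<open>Slicing the Hartogs triangle\<close>

definition vec2 :: "complex \<Rightarrow> complex \<Rightarrow> complex ^ 2" where
  "vec2 a b = (\<chi> i. if i = 1 then a else b)"

lemma vec2_nth [simp]: "vec2 a b $ 1 = a" "vec2 a b $ 2 = b"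
  by (simp_all add: vec2_def)

lemma vec2_eta [simp]: "vec2 (z $ 1) (z $ 2) = z"
  by (simp add: vec_eq_iff forall_2)

lemma continuous_on_vec2 [continuous_intros]:
  assumes "continuous_on A f" "continuous_on A g"
  shows "continuous_on A (\<lambda>x. vec2 (f x) (g x))"
  unfolding vec2_def
proof (rule continuous_on_vec_lambda)
  show "continuous_on A (\<lambda>x. if i = 1 then f x else g x)" for i :: 2
    using assms by (cases "i = 1") auto
qed

text \<open>
  The second coordinate comes first in the product because it is the outer integration variable
  in all later applications of Fubini's theorem.
\<close>

lemma lborel_distr_vec2:
  "distr (lborel \<Otimes>\<^sub>M lborel) borel (\<lambda>(b, a). vec2 a b) = lborel"
proof -
  have "distr lborel borel (\<lambda>(b, a). vec2 a b) = lborel"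
  proof (rule lborel_distr_basis)
    show "linear (\<lambda>(b, a). vec2 a b)"
      by (rule linearI) (auto simp: vec_eq_iff forall_2)
    have B: "(Basis :: (complex ^ 2) set) = {vec2 1 0, vec2 \<i> 0, vec2 0 1, vec2 0 \<i>}"
      by (auto simp: Basis_vec_def Basis_complex_def UNIV_2 vec_eq_iff forall_2 axis_def)
    show "bij_betw (\<lambda>(b, a). vec2 a b) Basis Basis"
      unfolding bij_betw_def B
      by (auto simp: inj_on_def Basis_prod_def Basis_complex_def vec_eq_iff forall_2)
  qed
  then show ?thesis by (simp add: lborel_prod)
qed

lemma measurable_vec2 [measurable]:
  "(\<lambda>(b, a). vec2 a b) \<in> borel_measurable (borel \<Otimes>\<^sub>M borel)"
  unfolding borel_prod case_prod_beta
  by (intro borel_measurable_continuous_onI continuous_intros)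

definition punctured_disc :: "complex set" where
  "punctured_disc = ball 0 1 - {0}"

lemma punctured_disc_sets [measurable]: "punctured_disc \<in> sets borel"
  unfolding punctured_disc_def by simp

abbreviation fibre :: "nat \<Rightarrow> complex \<Rightarrow> complex set" where
  "fibre k b \<equiv> ball 0 (cmod b powr (1 / real k))"

context
  fixes k :: nat
  assumes k: "k > 0"
begin

lemma power_less_iff_less_powr:
  assumes "b \<noteq> 0"
  shows "cmod a ^ k < cmod b \<longleftrightarrow> cmod a < cmod b powr (1 / real k)"
proof -
  have "(cmod b powr (1 / real k)) ^ k = cmod b powr (1 / real k * real k)"
    by (simp only: powr_powr [symmetric]) (use assms in \<open>simp add: powr_realpow\<close>)
  then have "cmod b = (cmod b powr (1 / real k)) ^ k"
    using assms k by simp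
  then have "cmod a ^ k < cmod b \<longleftrightarrow> cmod a ^ k < (cmod b powr (1 / real k)) ^ k"
    by simp
  also have "\<dots> \<longleftrightarrow> cmod a < cmod b powr (1 / real k)"
    using k by (metis norm_ge_zero power_less_imp_less_base power_strict_mono powr_ge_zero)
  finally show ?thesis .
qed

lemma vec2_mem_hartogs_triangle:
  "vec2 a b \<in> hartogs_triangle (real k) \<longleftrightarrow> b \<in> punctured_disc \<and> a \<in> fibre k b"
proof (cases "b = 0")
  case True
  then show ?thesis
    using k by (simp add: hartogs_triangle_of_nat punctured_disc_def not_less)
next
  case False
  then show ?thesis
    using k by (auto simp: hartogs_triangle_of_nat punctured_disc_def power_less_iff_less_powr)
qed

lemma open_hartogs_triangle: "open (hartogs_triangle (real k))"
  unfolding hartogs_triangle_of_nat[OF k]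
  by (intro open_Collect_conj open_Collect_less continuous_intros)

lemma indicator_hartogs_triangle:
  "indicator (hartogs_triangle (real k)) (vec2 a b) *\<^sub>R x =
   indicator punctured_disc b *\<^sub>R (indicator (fibre k b) a *\<^sub>R (x :: 'a :: real_vector))"
  by (simp add: indicator_def vec2_mem_hartogs_triangle)

lemma
  fixes G :: "complex ^ 2 \<Rightarrow> 'a :: {banach, second_countable_topology}"
  assumes G: "set_integrable lborel (hartogs_triangle (real k)) G"
  shows AE_integrable_fibre: "AE b in lborel. b \<in> punctured_disc \<longrightarrow>
      set_integrable lborel (fibre k b) (\<lambda>a. G (vec2 a b))"
    and integrable_integral_fibre: "set_integrable lborel punctured_disc
      (\<lambda>b. LINT a:fibre k b|lborel. G (vec2 a b))"
    and integral_hartogs_triangle: "(LINT w:hartogs_triangle (real k)|lborel. G w) =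
      (LINT b:punctured_disc|lborel. LINT a:fibre k b|lborel. G (vec2 a b))"
proof -
  let ?H = "hartogs_triangle (real k)"
  have "integrable (distr (lborel \<Otimes>\<^sub>M lborel) borel (\<lambda>(b, a). vec2 a b)) (\<lambda>w. indicator ?H w *\<^sub>R G w)"
    using G by (simp add: lborel_distr_vec2 set_integrable_def)
  then have int: "integrable (lborel \<Otimes>\<^sub>M lborel) (\<lambda>p. indicator ?H (vec2 (snd p) (fst p)) *\<^sub>R G (vec2 (snd p) (fst p)))"
    using G by (subst (asm) integrable_distr_eq) (auto simp: set_integrable_def case_prod_beta)
  have "AE b in lborel. integrable lborel (\<lambda>a. indicator ?H (vec2 a b) *\<^sub>R G (vec2 a b))"
    using lborel_pair.AE_integrable_fst'[OF int] by simp
  then show "AE b in lborel. b \<in> punctured_disc \<longrightarrow>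
      set_integrable lborel (fibre k b) (\<lambda>a. G (vec2 a b))"
    by eventually_elim (auto simp: indicator_hartogs_triangle set_integrable_def)
  have eq: "(LINT a|lborel. indicator ?H (vec2 a b) *\<^sub>R G (vec2 a b)) =
      indicator punctured_disc b *\<^sub>R (LINT a:fibre k b|lborel. G (vec2 a b))" for b
    unfolding indicator_hartogs_triangle set_lebesgue_integral_def by (rule integral_scaleR_right)
  show "set_integrable lborel punctured_disc (\<lambda>b. LINT a:fibre k b|lborel. G (vec2 a b))"
    using lborel_pair.integrable_fst'[OF int] unfolding set_integrable_def by (simp add: eq)
  have "(LINT w:?H|lborel. G w) =
      (LINT w|distr (lborel \<Otimes>\<^sub>M lborel) borel (\<lambda>(b, a). vec2 a b). indicator ?H w *\<^sub>R G w)"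
    by (simp add: lborel_distr_vec2 set_lebesgue_integral_def)
  also have "\<dots> = (LINT p|(lborel \<Otimes>\<^sub>M lborel). indicator ?H (vec2 (snd p) (fst p)) *\<^sub>R G (vec2 (snd p) (fst p)))"
    using G by (subst integral_distr) (auto simp: set_integrable_def case_prod_beta)
  also have "\<dots> = (LINT b|lborel. LINT a|lborel. indicator ?H (vec2 a b) *\<^sub>R G (vec2 a b))"
    using lborel_pair.integral_fst'[OF int] by simp
  also have "\<dots> = (LINT b:punctured_disc|lborel. LINT a:fibre k b|lborel. G (vec2 a b))"
    by (simp add: eq set_lebesgue_integral_def)
  finally show "(LINT w:?H|lborel. G w) = (LINT b:punctured_disc|lborel. LINT a:fibre k b|lborel. G (vec2 a b))" .
qed

end
section \<open>Taylor coefficients along the fibres\<close>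

lemma holomorphic_several_on_line:
  assumes f: "holomorphic_several_on f \<Omega>" and "open \<Omega>"
  shows "(\<lambda>c. f (v + c *s e)) holomorphic_on {c. v + c *s e \<in> \<Omega>}"
  unfolding holomorphic_on_def
proof
  fix c assume "c \<in> {c. v + c *s e \<in> \<Omega>}"
  then have c: "v + c *s e \<in> \<Omega>" by simp
  then obtain D where D: "(f has_derivative D) (at (v + c *s e) within \<Omega>)" "\<And>a u. D (a *s u) = a * D u"
    using f unfolding holomorphic_several_on_def by blast
  have D': "(f has_derivative D) (at (v + c *s e))"
    using D(1) at_within_open[OF c \<open>open \<Omega>\<close>] by simp
  have "linear (\<lambda>c. c *s e)"
    by (rule linearI) (auto simp: vec_eq_iff algebra_simps)
  then have "bounded_linear (\<lambda>c. c *s e)"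
    by (simp add: linear_conv_bounded_linear)
  then have "((\<lambda>c. v + c *s e) has_derivative (\<lambda>h. h *s e)) (at c)"
    by (auto intro!: derivative_eq_intros bounded_linear_imp_has_derivative)
  from has_derivative_compose[OF this D'] have "((\<lambda>c. f (v + c *s e)) has_derivative (\<lambda>h. D e * h)) (at c)"
    by (simp add: D(2) mult.commute)
  then show "(\<lambda>c. f (v + c *s e)) field_differentiable at c within {c. v + c *s e \<in> \<Omega>}"
    by (metis field_differentiable_at_within field_differentiable_def has_field_derivative_def)
qed

lemma vec2_line: "vec2 a b = vec2 0 b + a *s vec2 1 0" "vec2 a b = vec2 a 0 + b *s vec2 0 1"
  by (auto simp: vec_eq_iff forall_2)

context
  fixes k :: nat
  assumes k: "k > 0"
begin

lemma holomorphic_on_fibre: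
  assumes f: "holomorphic_several_on f (hartogs_triangle (real k))" and b: "b \<in> punctured_disc"
  shows "(\<lambda>a. f (vec2 a b)) holomorphic_on fibre k b"
  using holomorphic_several_on_line[OF f open_hartogs_triangle[OF k], of "vec2 0 b" "vec2 1 0"]
  unfolding vec2_line(1)[symmetric]
  by (rule holomorphic_on_subset) (use b in \<open>auto simp: vec2_mem_hartogs_triangle[OF k]\<close>)

lemma holomorphic_on_fibre_coeff:
  assumes f: "holomorphic_several_on f (hartogs_triangle (real k))"
  shows "(\<lambda>b. taylor_coeff (\<lambda>a. f (vec2 a b)) n) holomorphic_on punctured_disc"
proof -
  let ?c = "\<lambda>b. taylor_coeff (\<lambda>a. f (vec2 a b)) n"
  have "?c field_differentiable at b0" if b0: "b0 \<in> punctured_disc" for b0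
  proof -
    define \<delta> where "\<delta> = min (cmod b0 / 2) ((1 - cmod b0) / 2)"
    define r where "r = (cmod b0 / 2) powr (1 / real k) / 2"
    have \<delta>: "\<delta> > 0" and r: "r > 0"
      using b0 by (auto simp: \<delta>_def r_def punctured_disc_def)
    have sub: "vec2 a b \<in> hartogs_triangle (real k)" if "a \<in> cball 0 r" "b \<in> cball b0 \<delta>" for a b
    proof -
      have d: "cmod (b0 - b) \<le> cmod b0 / 2" "cmod (b0 - b) \<le> (1 - cmod b0) / 2"
        using that by (auto simp: \<delta>_def dist_norm)
      have "cmod b0 \<le> cmod b + cmod (b0 - b)" "cmod b \<le> cmod b0 + cmod (b0 - b)"
        using norm_triangle_sub[of b0 b] norm_triangle_sub[of b b0] by (auto simp: norm_minus_commute)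
      with d b0 have b: "cmod b0 / 2 \<le> cmod b" "cmod b < 1" "b \<noteq> 0"
        by (auto simp: punctured_disc_def)
      have "cmod a \<le> r" using that by simp
      also have "r < (cmod b0 / 2) powr (1 / real k)"
        using b0 by (simp add: r_def punctured_disc_def)
      also have "\<dots> \<le> cmod b powr (1 / real k)"
        using b by (intro powr_mono2) auto
      finally show ?thesis
        using b by (simp add: vec2_mem_hartogs_triangle[OF k] punctured_disc_def)
    qed
    have "?c holomorphic_on ball b0 \<delta>"
    proof (rule holomorphic_taylor_coeff_parameter[OF r])
      have "continuous_on (cball 0 r \<times> cball b0 \<delta>) (\<lambda>p. f (vec2 (fst p) (snd p)))"
        by (rule continuous_on_compose2[OF holomorphic_several_on_imp_continuous_on[OF f]])
           (use sub in \<open>auto intro!: continuous_intros\<close>)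
      then show "continuous_on (cball 0 r \<times> cball b0 \<delta>) (\<lambda>(a, b). f (vec2 a b))"
        by (simp add: case_prod_beta)
      show "(\<lambda>a. f (vec2 a b)) holomorphic_on ball 0 r" if "b \<in> cball b0 \<delta>" for b
        using holomorphic_several_on_line[OF f open_hartogs_triangle[OF k], of "vec2 0 b" "vec2 1 0"]
        unfolding vec2_line(1)[symmetric]
        by (rule holomorphic_on_subset) (use sub that in auto)
      show "(\<lambda>b. f (vec2 a b)) holomorphic_on ball b0 \<delta>" if "a \<in> ball 0 r" for a
        using holomorphic_several_on_line[OF f open_hartogs_triangle[OF k], of "vec2 a 0" "vec2 0 1"]
        unfolding vec2_line(2)[symmetric]
        by (rule holomorphic_on_subset) (use sub that in auto)
    qed
    then show ?thesis
      using \<delta> by (intro holomorphic_on_imp_differentiable_at[OF _ open_ball]) auto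
  qed
  then show ?thesis
    unfolding holomorphic_on_def by (blast intro: field_differentiable_at_within)
qed

lemma fibre_radius_power:
  assumes "b \<noteq> 0"
  shows "(cmod b powr (1 / real k)) ^ m = cmod b powr (real m / real k)"
  using assms by (simp add: powr_powr flip: powr_realpow)

text \<open>
  Bessel's inequality on each fibre, integrated over the punctured disc. The weight is the
  power \<open>2 * n + 2\<close> of the fibre's radius.
\<close>

lemma square_integrable_fibre_coeff:
  assumes f: "f \<in> bergman_space (hartogs_triangle (real k))"
  shows "set_integrable lborel punctured_disc
    (\<lambda>b. cmod b powr (2 * (real n + 1) / real k) * (cmod (taylor_coeff (\<lambda>a. f (vec2 a b)) n))\<^sup>2)"
proof -
  let ?c = "\<lambda>b. taylor_coeff (\<lambda>a. f (vec2 a b)) n"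
  let ?Q = "\<lambda>b. LINT a:fibre k b|lborel. (cmod (f (vec2 a b)))\<^sup>2"
  have f1: "holomorphic_several_on f (hartogs_triangle (real k))"
    and f2: "set_integrable lborel (hartogs_triangle (real k)) (\<lambda>z. (cmod (f z))\<^sup>2)"
    using f by (auto simp: bergman_space_def)
  have Q: "integrable lborel (\<lambda>b. (real n + 1) / pi * (indicator punctured_disc b *\<^sub>R ?Q b))"
    using integrable_integral_fibre[OF k f2] unfolding set_integrable_def by (rule integrable_mult_right)
  have "continuous_on punctured_disc (\<lambda>b. cmod b powr (2 * (real n + 1) / real k) * (cmod (?c b))\<^sup>2)"
    using holomorphic_on_imp_continuous_on[OF holomorphic_on_fibre_coeff[OF f1, of n]]
    by (intro continuous_intros) (auto simp: punctured_disc_def)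
  then have meas: "(\<lambda>b. indicator punctured_disc b *\<^sub>R (cmod b powr (2 * (real n + 1) / real k) * (cmod (?c b))\<^sup>2)) \<in> borel_measurable borel"
    by (intro borel_measurable_continuous_on_indicator) auto
  have "AE b in lborel. norm (indicator punctured_disc b *\<^sub>R (cmod b powr (2 * (real n + 1) / real k) * (cmod (?c b))\<^sup>2))
      \<le> norm ((real n + 1) / pi * (indicator punctured_disc b *\<^sub>R ?Q b))"
    using AE_integrable_fibre[OF k f2]
  proof eventually_elim
    case (elim b)
    show ?case
    proof (cases "b \<in> punctured_disc")
      case True
      then have b: "b \<noteq> 0" by (simp add: punctured_disc_def)
      have "(cmod (?c b))\<^sup>2 * (pi * (cmod b powr (1 / real k)) ^ (2 * n + 2) / (real n + 1)) \<le> ?Q b"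
        by (rule bessel_disc) (use elim True b holomorphic_on_fibre[OF f1 True] in auto)
      also have "(cmod b powr (1 / real k)) ^ (2 * n + 2) = cmod b powr (2 * (real n + 1) / real k)"
        using fibre_radius_power[OF b, of "2 * n + 2"] by (simp add: algebra_simps)
      finally have le: "cmod b powr (2 * (real n + 1) / real k) * (cmod (?c b))\<^sup>2 \<le> (real n + 1) / pi * ?Q b"
        by (simp add: field_simps)
      have "0 \<le> cmod b powr (2 * (real n + 1) / real k) * (cmod (?c b))\<^sup>2" by simp
      moreover from le have "cmod b powr (2 * (real n + 1) / real k) * (cmod (?c b))\<^sup>2 \<le> \<bar>(real n + 1) / pi * ?Q b\<bar>"
        by linarith
      ultimately show ?thesis
        using True by (simp only: indicator_simps(1) scaleR_one real_norm_def abs_of_nonneg)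
    qed simp
  qed
  with Q meas show ?thesis
    unfolding set_integrable_def by (intro Bochner_Integration.integrable_bound[OF Q]) auto
qed

text \<open>
  With \<open>n = k * \<alpha> + i\<close>, the weight of the preceding lemma is
  \<open>cmod b powr (2 * \<nu> - 2)\<close> times the squared modulus of \<open>b ^ Suc \<alpha>\<close>. Hence
  \<open>h b = b ^ Suc \<alpha> * c b\<close> is square integrable with respect to the weight
  \<open>cmod b powr (2 * \<nu> - 2)\<close>. Since \<open>\<nu> \<le> 1\<close>, this weight is at least \<open>1\<close>, so \<open>h\<close>
  extends over the origin and the weighted reproducing formula applies to it. This is where
  square integrability excludes the negative powers of the second variable that would
  spoil the formula.
\<close>

lemma fibre_coeff_reproducing:
  fixes \<alpha> :: nat
  assumes f: "f \<in> bergman_space (hartogs_triangle (real k))" and i: "i < k" and z: "z \<in> punctured_disc"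
  defines "\<nu> \<equiv> (real i + 1) / real k" and "c \<equiv> \<lambda>b. taylor_coeff (\<lambda>a. f (vec2 a b)) (k * \<alpha> + i)"
  shows "(LINT b:punctured_disc|lborel. of_real (cmod b powr (2 * \<nu> - 2)) *
    ((of_real \<nu> + (1 - of_real \<nu>) * (z * cnj b)) / (1 - z * cnj b)\<^sup>2 * (b ^ Suc \<alpha> * c b))) =
    of_real pi * (z ^ Suc \<alpha> * c z)"
proof -
  define h where "h b = b ^ Suc \<alpha> * c b" for b
  have \<nu>: "0 < \<nu>" "\<nu> \<le> 1" using k i by (auto simp: \<nu>_def field_simps)
  have hol: "h holomorphic_on punctured_disc"
    unfolding h_def c_def using f
    by (intro holomorphic_intros holomorphic_on_fibre_coeff) (auto simp: bergman_space_def)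
  have weight: "cmod b powr (2 * \<nu> - 2) * (cmod (h b))\<^sup>2 =
      cmod b powr (2 * (real (k * \<alpha> + i) + 1) / real k) * (cmod (c b))\<^sup>2" if "b \<in> punctured_disc" for b
  proof -
    have b: "cmod b > 0" using that by (simp add: punctured_disc_def)
    have "2 * (real (k * \<alpha> + i) + 1) / real k = (2 * \<nu> - 2) + real (2 * Suc \<alpha>)"
      using k by (simp add: \<nu>_def field_simps)
    then have "cmod b powr (2 * (real (k * \<alpha> + i) + 1) / real k) = cmod b powr (2 * \<nu> - 2) * cmod b ^ (2 * Suc \<alpha>)"
      using b by (simp only: powr_add powr_realpow)
    then show ?thesis
      by (simp add: h_def norm_mult norm_power power_mult_distrib power2_eq_square mult_ac flip: power_mult)
         (simp add: power_mult power2_eq_square mult_ac power_mult_distrib)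
  qed
  have wint: "set_integrable lborel punctured_disc (\<lambda>b. cmod b powr (2 * \<nu> - 2) * (cmod (h b))\<^sup>2)"
    using square_integrable_fibre_coeff[OF f, of "k * \<alpha> + i"] weight
    by (subst set_integrable_cong[OF refl refl weight]) (auto simp: c_def)
  have hcont: "continuous_on punctured_disc h"
    by (rule holomorphic_on_imp_continuous_on[OF hol])
  have "set_integrable lborel punctured_disc (\<lambda>b. (cmod (h b))\<^sup>2)"
    unfolding set_integrable_def
  proof (rule Bochner_Integration.integrable_bound[OF wint[unfolded set_integrable_def]])
    show "(\<lambda>b. indicator punctured_disc b *\<^sub>R (cmod (h b))\<^sup>2) \<in> borel_measurable lborel"
      using borel_measurable_continuous_on_indicator[of punctured_disc "\<lambda>b. (cmod (h b))\<^sup>2"] hcont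
      by (simp add: continuous_intros)
    show "AE b in lborel. norm (indicator punctured_disc b *\<^sub>R (cmod (h b))\<^sup>2) \<le>
        norm (indicator punctured_disc b *\<^sub>R (cmod b powr (2 * \<nu> - 2) * (cmod (h b))\<^sup>2))"
    proof (rule AE_I2)
      fix b
      show "norm (indicator punctured_disc b *\<^sub>R (cmod (h b))\<^sup>2) \<le>
        norm (indicator punctured_disc b *\<^sub>R (cmod b powr (2 * \<nu> - 2) * (cmod (h b))\<^sup>2))"
      proof (cases "b \<in> punctured_disc")
        case True
        then have "0 < cmod b" "cmod b \<le> 1" by (auto simp: punctured_disc_def)
        then have "cmod b powr 0 \<le> cmod b powr (2 * \<nu> - 2)"
          using \<nu> by (intro powr_mono') auto
        with \<open>0 < cmod b\<close> have "1 * (cmod (h b))\<^sup>2 \<le> cmod b powr (2 * \<nu> - 2) * (cmod (h b))\<^sup>2"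
          by (intro mult_right_mono) auto
        with True show ?thesis by simp
      qed simp
    qed
  qed
  then obtain g where g: "g holomorphic_on ball 0 1" "\<And>b. b \<in> punctured_disc \<Longrightarrow> g b = h b"
    using square_integrable_removable[of h] hol unfolding punctured_disc_def by blast
  have gcont: "continuous_on (ball 0 1) g"
    by (rule holomorphic_on_imp_continuous_on[OF g(1)])
  have "set_integrable lborel (ball 0 1) (\<lambda>b. of_real (cmod b powr (2 * \<nu> - 2)) * g b)"
    unfolding set_integrable_def
  proof (rule Bochner_Integration.integrable_bound)
    show "integrable lborel (\<lambda>b. indicator (ball 0 1) b *\<^sub>R cmod b powr (2 * \<nu> - 2) +
        indicator punctured_disc b *\<^sub>R (cmod b powr (2 * \<nu> - 2) * (cmod (h b))\<^sup>2))"
      using wint set_integrable_cmod_powr_disc[OF zero_less_one \<nu>(1)] unfolding set_integrable_def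
      by (intro Bochner_Integration.integrable_add)
    have [measurable]: "(\<lambda>b. indicator (ball 0 1) b *\<^sub>R g b) \<in> borel_measurable lborel"
      using borel_measurable_continuous_on_indicator[OF _ gcont] by simp
    have "(\<lambda>b. complex_of_real (cmod b powr (2 * \<nu> - 2)) * (indicator (ball 0 1) b *\<^sub>R g b)) \<in> borel_measurable lborel"
      by measurable
    then show "(\<lambda>b. indicator (ball 0 1) b *\<^sub>R (complex_of_real (cmod b powr (2 * \<nu> - 2)) * g b)) \<in> borel_measurable lborel"
      by (simp only: scaleR_conv_of_real mult.left_commute)
    show "AE b in lborel. norm (indicator (ball 0 1) b *\<^sub>R (complex_of_real (cmod b powr (2 * \<nu> - 2)) * g b)) \<le>
        norm (indicator (ball 0 1) b *\<^sub>R cmod b powr (2 * \<nu> - 2) +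
        indicator punctured_disc b *\<^sub>R (cmod b powr (2 * \<nu> - 2) * (cmod (h b))\<^sup>2))"
      using AE_lborel_singleton[of "0::complex"]
    proof eventually_elim
      case (elim b)
      show ?case
      proof (cases "b \<in> ball 0 1")
        case True
        with elim have b: "b \<in> punctured_disc" by (simp add: punctured_disc_def)
        \<comment> \<open>The weight itself is integrable, so it suffices to dominate \<open>cmod (h b)\<close> by
            \<open>1 + (cmod (h b))\<^sup>2\<close>.\<close>
        have "0 \<le> (cmod (h b) - 1 / 2)\<^sup>2" by simp
        then have "cmod (h b) \<le> 1 + (cmod (h b))\<^sup>2"
          by (simp add: power2_eq_square algebra_simps)
        then have "cmod b powr (2 * \<nu> - 2) * cmod (h b) \<le> cmod b powr (2 * \<nu> - 2) * (1 + (cmod (h b))\<^sup>2)"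
          by (intro mult_left_mono) auto
        with True b show ?thesis by (simp add: g(2) norm_mult distrib_left)
      qed simp
    qed
  qed
  then have "(LINT b:ball 0 1|lborel. of_real (cmod b powr (2 * \<nu> - 2)) *
      ((of_real \<nu> + (1 - of_real \<nu>) * (z * cnj b)) / (1 - z * cnj b)\<^sup>2 * g b)) = of_real pi * g z"
    by (intro weighted_disc_reproducing g(1) \<nu>(1)) (use z in \<open>simp add: punctured_disc_def\<close>)
  moreover have "(LINT b:ball 0 1|lborel. of_real (cmod b powr (2 * \<nu> - 2)) *
      ((of_real \<nu> + (1 - of_real \<nu>) * (z * cnj b)) / (1 - z * cnj b)\<^sup>2 * g b)) =
      (LINT b:punctured_disc|lborel. of_real (cmod b powr (2 * \<nu> - 2)) *
      ((of_real \<nu> + (1 - of_real \<nu>) * (z * cnj b)) / (1 - z * cnj b)\<^sup>2 * h b))"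
    unfolding set_lebesgue_integral_def
  proof (rule Bochner_Integration.integral_cong[OF refl])
    fix b :: complex
    show "indicat_real (ball 0 1) b *\<^sub>R (of_real (cmod b powr (2 * \<nu> - 2)) *
      ((of_real \<nu> + (1 - of_real \<nu>) * (z * cnj b)) / (1 - z * cnj b)\<^sup>2 * g b)) =
      indicat_real punctured_disc b *\<^sub>R (of_real (cmod b powr (2 * \<nu> - 2)) *
      ((of_real \<nu> + (1 - of_real \<nu>) * (z * cnj b)) / (1 - z * cnj b)\<^sup>2 * h b))"
      by (cases "b = 0") (auto simp: g(2) indicator_def, auto simp: punctured_disc_def)
  qed
  ultimately show ?thesis using g(2)[OF z] by (simp add: h_def)
qed

end

section \<open>The kernel as a sum over residue classes\<close>
text \<open>
  The closed form of the sum of \<open>(n + 1) * x ^ \<alpha>\<close> over the arithmetic progression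
  \<open>n = k * \<alpha> + i\<close>.
\<close>

definition progression_kernel :: "nat \<Rightarrow> nat \<Rightarrow> complex \<Rightarrow> complex" where
  "progression_kernel k i x = (of_nat (Suc i) + of_nat (k - Suc i) * x) / (1 - x)\<^sup>2"

text \<open>
  Up to the factor \<open>k\<close>, this is the weighted disc kernel for \<open>\<nu> = (i + 1) / k\<close>.
\<close>

lemma progression_kernel_eq:
  assumes "i < k"
  defines "\<nu> \<equiv> (real i + 1) / real k"
  shows "progression_kernel k i x = of_nat k * ((of_real \<nu> + (1 - of_real \<nu>) * x) / (1 - x)\<^sup>2)"
proof -
  have "complex_of_real (real k * \<nu>) = of_nat (Suc i)"
    using assms by (simp add: \<nu>_def)
  then have 1: "of_nat (Suc i) = of_nat k * complex_of_real \<nu>"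
    by simp
  have 2: "of_nat (k - Suc i) = of_nat k * (1 - complex_of_real \<nu>)"
    using assms(1) 1 by (simp add: of_nat_diff algebra_simps)
  show ?thesis
    unfolding progression_kernel_def 1 2 by (simp add: distrib_left mult.assoc)
qed

lemma progression_kernel_sums:
  assumes "i < k" "cmod x < 1"
  shows "(\<lambda>\<alpha>. of_nat (k * \<alpha> + i + 1) * x ^ \<alpha>) sums progression_kernel k i x"
proof -
  define \<nu> where "\<nu> = (real i + 1) / real k"
  have "of_nat k * (complex_of_real (real \<alpha> + \<nu>) * x ^ \<alpha>) = of_nat (k * \<alpha> + i + 1) * x ^ \<alpha>" for \<alpha>
  proof -
    have "complex_of_real (real k * (real \<alpha> + \<nu>)) = of_nat (k * \<alpha> + i + 1)"
      using assms(1) by (simp add: \<nu>_def field_simps)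
    then show ?thesis by (simp flip: mult.assoc)
  qed
  with sums_mult[OF weighted_geometric_sums[OF assms(2), of \<nu>], of "of_nat k"]
  show ?thesis
    by (simp only: progression_kernel_eq[OF assms(1), folded \<nu>_def])
qed

lemma cmod_progression_kernel_le:
  assumes "i < k" "cmod x \<le> \<rho>" "\<rho> < 1"
  shows "cmod (progression_kernel k i x) \<le> real k / (1 - \<rho>)\<^sup>2"
proof -
  have "1 - \<rho> \<le> cmod (1 - x)"
    using norm_triangle_ineq2[of 1 x] assms by simp
  then have "(1 - \<rho>)\<^sup>2 \<le> (cmod (1 - x))\<^sup>2"
    using assms by (intro power_mono) auto
  moreover have "cmod (of_nat (Suc i) + of_nat (k - Suc i) * x) \<le> real k"
  proof -
    have "cmod (of_nat (Suc i) + of_nat (k - Suc i) * x) \<le> real (Suc i) + real (k - Suc i) * cmod x"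
      by (rule order_trans[OF norm_triangle_ineq]) (simp add: norm_mult del: of_nat_Suc)
    also have "\<dots> \<le> real (Suc i) + real (k - Suc i) * 1"
      using assms by (intro add_left_mono mult_left_mono) auto
    also have "\<dots> = real k" using assms(1) by simp
    finally show ?thesis .
  qed
  ultimately show ?thesis
    unfolding progression_kernel_def norm_divide norm_power
    using assms by (intro frac_le) auto
qed

text \<open>
  The orthonormal expansion of the Bergman kernel, restricted to the monomials whose exponent
  in the first variable is congruent to \<open>i\<close> modulo \<open>k\<close>, and without the common
  factor \<open>1 / (k * \<pi>\<^sup>2)\<close>. Within one residue class the double series is a product of two
  single series, in \<open>s ^ k / t\<close> and in \<open>t\<close>.
\<close>

definition hartogs_kernel_part :: "nat \<Rightarrow> nat \<Rightarrow> complex ^ 2 \<Rightarrow> complex ^ 2 \<Rightarrow> complex" where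
  "hartogs_kernel_part k i z w =
    (let s = z $ 1 * cnj (w $ 1); t = z $ 2 * cnj (w $ 2)
     in s ^ i * progression_kernel k i (s ^ k / t) * progression_kernel k i t / t)"

definition hartogs_kernel :: "nat \<Rightarrow> complex ^ 2 \<Rightarrow> complex ^ 2 \<Rightarrow> complex" where
  "hartogs_kernel k z w = (\<Sum>i<k. hartogs_kernel_part k i z w) / (of_nat k * of_real pi ^ 2)"

context
  fixes k :: nat
  assumes k: "k > 0"
begin

lemma hartogs_triangle_bounds:
  fixes z :: "complex ^ 2"
  assumes "z \<in> hartogs_triangle (real k)"
  shows "cmod (z $ 1) < 1" "0 < cmod (z $ 2)" "cmod (z $ 2) < 1" "cmod (z $ 1) ^ k < cmod (z $ 2)"
proof -
  show *: "cmod (z $ 1) ^ k < cmod (z $ 2)" "cmod (z $ 2) < 1"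
    using assms by (auto simp: hartogs_triangle_of_nat[OF k])
  have "0 \<le> cmod (z $ 1) ^ k" by simp
  with * show "0 < cmod (z $ 2)" by linarith
  have "cmod (z $ 1) ^ k < 1 ^ k" using * by simp
  then show "cmod (z $ 1) < 1" by (rule power_less_imp_less_base) simp
qed

text \<open>
  Both series variables \<open>s ^ k / t\<close> and \<open>t\<close> stay in a fixed disc of radius below
  \<open>1\<close> when \<open>z\<close> is fixed and \<open>w\<close> varies. The only factor of the kernel that is unbounded
  in \<open>w\<close> is therefore \<open>1 / t\<close>.
\<close>

lemma hartogs_ratio_bounds:
  fixes z w :: "complex ^ 2"
  assumes z: "z \<in> hartogs_triangle (real k)" and w: "w \<in> hartogs_triangle (real k)"
  defines "s \<equiv> z $ 1 * cnj (w $ 1)" and "t \<equiv> z $ 2 * cnj (w $ 2)"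
  shows "cmod (s ^ k / t) \<le> cmod (z $ 1) ^ k / cmod (z $ 2)" "cmod (z $ 1) ^ k / cmod (z $ 2) < 1"
    "cmod t \<le> cmod (z $ 2)" "cmod s \<le> 1" "t \<noteq> 0"
proof -
  note zb = hartogs_triangle_bounds[OF z] and wb = hartogs_triangle_bounds[OF w]
  have "cmod (s ^ k / t) = (cmod (z $ 1) ^ k / cmod (z $ 2)) * (cmod (w $ 1) ^ k / cmod (w $ 2))"
    by (simp add: s_def t_def norm_divide norm_mult norm_power power_mult_distrib)
  also have "\<dots> \<le> (cmod (z $ 1) ^ k / cmod (z $ 2)) * 1"
    using wb by (intro mult_left_mono) auto
  finally show "cmod (s ^ k / t) \<le> cmod (z $ 1) ^ k / cmod (z $ 2)" by simp
  show "cmod (z $ 1) ^ k / cmod (z $ 2) < 1" using zb by simp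
  have "cmod (z $ 2) * cmod (w $ 2) \<le> cmod (z $ 2) * 1"
    using wb by (intro mult_left_mono) auto
  then show "cmod t \<le> cmod (z $ 2)" by (simp add: t_def norm_mult)
  have "cmod (z $ 1) * cmod (w $ 1) \<le> 1 * 1"
    using zb wb by (intro mult_mono) auto
  then show "cmod s \<le> 1" by (simp add: s_def norm_mult)
  show "t \<noteq> 0" using zb wb by (auto simp: t_def)
qed

lemma cmod_hartogs_kernel_part_le:
  fixes z :: "complex ^ 2"
  assumes z: "z \<in> hartogs_triangle (real k)" and i: "i < k"
  shows "\<exists>C\<ge>0. \<forall>w\<in>hartogs_triangle (real k). cmod (hartogs_kernel_part k i z w) \<le> C / cmod (w $ 2)"
proof -
  define \<rho> where "\<rho> = cmod (z $ 1) ^ k / cmod (z $ 2)"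
  define A where "A = real k / (1 - \<rho>)\<^sup>2"
  define B where "B = real k / (1 - cmod (z $ 2))\<^sup>2"
  have "cmod (hartogs_kernel_part k i z w) \<le> (A * B / cmod (z $ 2)) / cmod (w $ 2)"
    if w: "w \<in> hartogs_triangle (real k)" for w :: "complex ^ 2"
  proof -
    define s where "s = z $ 1 * cnj (w $ 1)"
    define t where "t = z $ 2 * cnj (w $ 2)"
    note b = hartogs_ratio_bounds[OF z w, folded s_def t_def, folded \<rho>_def]
    have "cmod s ^ i * cmod (progression_kernel k i (s ^ k / t)) * cmod (progression_kernel k i t) \<le> 1 * A * B"
      unfolding A_def B_def using b hartogs_triangle_bounds[OF z]
      by (intro mult_mono cmod_progression_kernel_le[OF i] power_le_one) (auto intro!: mult_nonneg_nonneg)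
    then have "cmod (hartogs_kernel_part k i z w) \<le> 1 * A * B / cmod t"
      unfolding hartogs_kernel_part_def Let_def s_def[symmetric] t_def[symmetric] norm_divide norm_mult norm_power
      by (intro divide_right_mono) auto
    then show ?thesis by (simp add: t_def norm_mult)
  qed
  moreover have "A * B / cmod (z $ 2) \<ge> 0" by (simp add: A_def B_def)
  ultimately show ?thesis by blast
qed

text \<open>
  The fibre over \<open>b\<close> has area \<open>\<pi> * cmod b powr (2 / k)\<close>, and this shrinking
  is what makes \<open>1 / (cmod b)\<^sup>2\<close> integrable. The function \<open>1 / w $ 2\<close> dominates the
  kernel, so this lemma gives both the membership of the kernel in the Bergman space and the
  integrable majorants for exchanging sums with integrals.
\<close>

lemma square_integrable_inverse_second:
  "set_integrable lborel (hartogs_triangle (real k)) (\<lambda>w :: complex ^ 2. (cmod (1 / w $ 2))\<^sup>2)"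
proof -
  let ?H = "hartogs_triangle (real k)"
  define G where "G w = indicator ?H w *\<^sub>R (cmod (1 / w $ 2))\<^sup>2" for w :: "complex ^ 2"
  have "continuous_on ?H (\<lambda>w :: complex ^ 2. (cmod (1 / w $ 2))\<^sup>2)"
    using hartogs_triangle_bounds(2) by (intro continuous_intros) auto
  then have [measurable]: "G \<in> borel_measurable borel"
    unfolding G_def using open_hartogs_triangle[OF k]
    by (intro borel_measurable_continuous_on_indicator) auto
  have Geq: "G (vec2 a b) = indicator punctured_disc b * (1 / (cmod b)\<^sup>2) * indicator (fibre k b) a" for a b
    using indicator_hartogs_triangle[OF k, of a b "(cmod (1 / b))\<^sup>2"]
    by (simp add: G_def norm_divide power_divide)
  have area: "measure lborel (fibre k b) = pi * cmod b powr (2 / real k)" if "b \<noteq> 0" for b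
    using that k fibre_radius_power[OF k that, of 2]
    by (simp add: content_ball unit_ball_vol_2)
  have "integrable (lborel \<Otimes>\<^sub>M lborel) (\<lambda>(b, a). G (vec2 a b))"
  proof (rule lborel_pair.Fubini_integrable)
    show "(\<lambda>(b, a). G (vec2 a b)) \<in> borel_measurable (lborel \<Otimes>\<^sub>M lborel)"
      by measurable
    have fin: "emeasure lborel (fibre k b) < \<infinity>" for b
      by (rule emeasure_lborel_ball_finite)
    have eq: "(LINT a|lborel. norm (G (vec2 a b))) = indicator punctured_disc b * (1 / (cmod b)\<^sup>2) * measure lborel (fibre k b)" for b
      using fin[of b] unfolding Geq by (simp add: abs_mult)
    have "(LINT a|lborel. norm (G (vec2 a b))) = pi * (indicator (ball 0 1) b *\<^sub>R cmod b powr (2 * (1 / real k) - 2))" for b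
    proof (cases "b = 0")
      case False
      then have "cmod b powr (2 * (1 / real k) - 2) = cmod b powr (2 / real k) / (cmod b)\<^sup>2"
        by (simp add: powr_diff)
      then show ?thesis
        using False unfolding eq area[OF False] by (simp add: punctured_disc_def indicator_def)
    next
      case True
      then show ?thesis unfolding eq by (simp add: punctured_disc_def)
    qed
    moreover have "integrable lborel (\<lambda>b::complex. pi * (indicator (ball 0 1) b *\<^sub>R cmod b powr (2 * (1 / real k) - 2)))"
      using set_integrable_cmod_powr_disc[of 1 "1 / real k"] k unfolding set_integrable_def
      by (intro integrable_mult_right) auto
    ultimately show "integrable lborel (\<lambda>b. LINT a|lborel. norm (case (b, a) of (b, a) \<Rightarrow> G (vec2 a b)))"
      by simp
    show "AE b in lborel. integrable lborel (\<lambda>a. case (b, a) of (b, a) \<Rightarrow> G (vec2 a b))"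
      using fin unfolding Geq by (intro AE_I2) auto
  qed
  then have "integrable (distr (lborel \<Otimes>\<^sub>M lborel) borel (\<lambda>(b, a). vec2 a b)) G"
    by (subst integrable_distr_eq) (auto simp: case_prod_unfold)
  then show ?thesis
    by (simp add: lborel_distr_vec2 set_integrable_def G_def [abs_def])
qed

lemma integrable_over_second:
  assumes f: "f \<in> bergman_space (hartogs_triangle (real k))"
  shows "set_integrable lborel (hartogs_triangle (real k)) (\<lambda>w :: complex ^ 2. 1 / w $ 2 * f w)"
proof (rule set_integrable_mult_L2[OF open_hartogs_triangle[OF k]])
  show "continuous_on (hartogs_triangle (real k)) (\<lambda>w :: complex ^ 2. 1 / w $ 2)"
    using hartogs_triangle_bounds(2) by (intro continuous_intros) auto
qed (use f square_integrable_inverse_second holomorphic_several_on_imp_continuous_on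
     in \<open>auto simp: bergman_space_def\<close>)

end

section \<open>The reproducing property\<close>
context
  fixes k :: nat
  assumes k: "k > 0"
begin

lemma hartogs_kernel_part_sums:
  fixes z w :: "complex ^ 2"
  assumes z: "z \<in> hartogs_triangle (real k)" and w: "w \<in> hartogs_triangle (real k)" and i: "i < k"
  shows "(\<lambda>\<alpha>. of_nat (k * \<alpha> + i + 1) * ((z $ 1 * cnj (w $ 1)) ^ (k * \<alpha> + i) *
      progression_kernel k i (z $ 2 * cnj (w $ 2)) / (z $ 2 * cnj (w $ 2)) ^ Suc \<alpha>)) sums
    hartogs_kernel_part k i z w"
proof -
  define s where "s = z $ 1 * cnj (w $ 1)"
  define t where "t = z $ 2 * cnj (w $ 2)"
  note b = hartogs_ratio_bounds[OF k z w, folded s_def t_def]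
  have "cmod (s ^ k / t) < 1" using b(1,2) by linarith
  from sums_mult2[OF progression_kernel_sums[OF i this], of "s ^ i * progression_kernel k i t / t"]
  have "(\<lambda>\<alpha>. of_nat (k * \<alpha> + i + 1) * (s ^ k / t) ^ \<alpha> * (s ^ i * progression_kernel k i t / t)) sums
      hartogs_kernel_part k i z w"
    by (simp add: hartogs_kernel_part_def Let_def s_def t_def mult_ac)
  moreover have "of_nat (k * \<alpha> + i + 1) * (s ^ k / t) ^ \<alpha> * (s ^ i * progression_kernel k i t / t) =
      of_nat (k * \<alpha> + i + 1) * (s ^ (k * \<alpha> + i) * progression_kernel k i t / t ^ Suc \<alpha>)" for \<alpha>
  proof -
    have "s ^ (k * \<alpha> + i) = (s ^ k) ^ \<alpha> * s ^ i" by (simp only: power_add power_mult)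
    then show ?thesis by (simp add: power_divide mult_ac)
  qed
  ultimately show ?thesis unfolding s_def t_def by simp
qed

lemma hartogs_kernel_part_summand_bound:
  fixes z w :: "complex ^ 2"
  assumes z: "z \<in> hartogs_triangle (real k)" and w: "w \<in> hartogs_triangle (real k)" and i: "i < k"
  shows "cmod ((z $ 1 * cnj (w $ 1)) ^ (k * \<alpha> + i) *
      progression_kernel k i (z $ 2 * cnj (w $ 2)) / (z $ 2 * cnj (w $ 2)) ^ Suc \<alpha>) \<le>
    (cmod (z $ 1) ^ k / cmod (z $ 2)) ^ \<alpha> * (real k / (1 - cmod (z $ 2))\<^sup>2 / cmod (z $ 2)) * cmod (1 / w $ 2)"
proof -
  define s where "s = z $ 1 * cnj (w $ 1)"
  define t where "t = z $ 2 * cnj (w $ 2)"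
  define \<rho> where "\<rho> = cmod (z $ 1) ^ k / cmod (z $ 2)"
  note b = hartogs_ratio_bounds[OF k z w, folded s_def t_def, folded \<rho>_def]
  note zb = hartogs_triangle_bounds[OF k z]
  have "s ^ (k * \<alpha> + i) * progression_kernel k i t / t ^ Suc \<alpha> =
      (s ^ k / t) ^ \<alpha> * s ^ i * progression_kernel k i t / t"
  proof -
    have "s ^ (k * \<alpha> + i) = (s ^ k) ^ \<alpha> * s ^ i" by (simp only: power_add power_mult)
    then show ?thesis by (simp add: power_divide mult_ac)
  qed
  then have "cmod (s ^ (k * \<alpha> + i) * progression_kernel k i t / t ^ Suc \<alpha>) =
      cmod (s ^ k / t) ^ \<alpha> * cmod s ^ i * cmod (progression_kernel k i t) / cmod t"
    by (simp only: norm_mult norm_divide norm_power)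
  also have "\<dots> \<le> \<rho> ^ \<alpha> * 1 * (real k / (1 - cmod (z $ 2))\<^sup>2) / cmod t"
    using b zb
    by (intro divide_right_mono mult_mono power_mono cmod_progression_kernel_le[OF i] power_le_one)
       (auto simp: \<rho>_def intro!: mult_nonneg_nonneg)
  also have "\<dots> = \<rho> ^ \<alpha> * (real k / (1 - cmod (z $ 2))\<^sup>2 / cmod (z $ 2)) * cmod (1 / w $ 2)"
    by (simp add: t_def norm_mult norm_divide)
  finally show ?thesis unfolding s_def t_def \<rho>_def .
qed

lemma continuous_on_hartogs_kernel_part_summand:
  fixes z :: "complex ^ 2"
  assumes z: "z \<in> hartogs_triangle (real k)"
  shows "continuous_on (hartogs_triangle (real k)) (\<lambda>w. (z $ 1 * cnj (w $ 1)) ^ (k * \<alpha> + i) *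
      progression_kernel k i (z $ 2 * cnj (w $ 2)) / (z $ 2 * cnj (w $ 2)) ^ Suc \<alpha>)"
proof -
  have "z $ 2 * cnj (w $ 2) \<noteq> 0" "1 - z $ 2 * cnj (w $ 2) \<noteq> 0"
    if w: "w \<in> hartogs_triangle (real k)" for w :: "complex ^ 2"
    using hartogs_ratio_bounds[OF k z w] hartogs_triangle_bounds[OF k z] by auto
  then show ?thesis
    unfolding progression_kernel_def by (intro continuous_intros) auto
qed

text \<open>
  The fibre integral extracts the \<open>n\<close>-th Taylor coefficient in the first variable. Its norming
  factor, the power \<open>2 * n + 2\<close> of the radius of the fibre, turns the integral over the second
  variable into the weighted disc formula for \<open>\<nu> = (i + 1) / k\<close>.
\<close>

lemma integral_hartogs_kernel_part_summand:
  fixes z :: "complex ^ 2" and \<alpha> :: nat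
  assumes f: "f \<in> bergman_space (hartogs_triangle (real k))"
    and z: "z \<in> hartogs_triangle (real k)" and i: "i < k"
  defines "n \<equiv> k * \<alpha> + i"
  defines "T \<equiv> \<lambda>w :: complex ^ 2. (z $ 1 * cnj (w $ 1)) ^ n *
      progression_kernel k i (z $ 2 * cnj (w $ 2)) / (z $ 2 * cnj (w $ 2)) ^ Suc \<alpha>"
  shows "set_integrable lborel (hartogs_triangle (real k)) (\<lambda>w. T w * f w)"
    and "of_nat (n + 1) * (LINT w:hartogs_triangle (real k)|lborel. T w * f w) =
      of_nat k * of_real pi ^ 2 * (taylor_coeff (\<lambda>a. f (vec2 a (z $ 2))) n * (z $ 1) ^ n)"
proof -
  let ?H = "hartogs_triangle (real k)"
  define c where "c = (\<lambda>b. taylor_coeff (\<lambda>a. f (vec2 a b)) n)"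
  define \<nu> where "\<nu> = (real i + 1) / real k"
  have f1: "holomorphic_several_on f ?H" and f2: "set_integrable lborel ?H (\<lambda>z. (cmod (f z))\<^sup>2)"
    using f by (auto simp: bergman_space_def)
  have fcont: "continuous_on ?H f"
    by (rule holomorphic_several_on_imp_continuous_on[OF f1])
  show int: "set_integrable lborel ?H (\<lambda>w. T w * f w)"
    unfolding set_integrable_def
  proof (rule Bochner_Integration.integrable_bound)
    define C where "C = (cmod (z $ 1) ^ k / cmod (z $ 2)) ^ \<alpha> * (real k / (1 - cmod (z $ 2))\<^sup>2 / cmod (z $ 2))"
    show "integrable lborel (\<lambda>w. C * norm (indicator ?H w *\<^sub>R (1 / w $ 2 * f w)))"
      using integrable_over_second[OF k f] unfolding set_integrable_def
      by (intro integrable_mult_right integrable_norm)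
    show "(\<lambda>w. indicator ?H w *\<^sub>R (T w * f w)) \<in> borel_measurable lborel"
      using borel_measurable_continuous_on_indicator[of ?H "\<lambda>w. T w * f w"] open_hartogs_triangle[OF k]
        continuous_on_mult[OF continuous_on_hartogs_kernel_part_summand[OF z, of \<alpha> i] fcont]
      by (simp add: T_def n_def)
    show "AE w in lborel. norm (indicator ?H w *\<^sub>R (T w * f w)) \<le> norm (C * norm (indicator ?H w *\<^sub>R (1 / w $ 2 * f w)))"
    proof (rule AE_I2)
      fix w :: "complex ^ 2"
      show "norm (indicator ?H w *\<^sub>R (T w * f w)) \<le> norm (C * norm (indicator ?H w *\<^sub>R (1 / w $ 2 * f w)))"
      proof (cases "w \<in> ?H")
        case True
        have "C \<ge> 0" by (simp add: C_def)
        have "cmod (T w) * cmod (f w) \<le> C * cmod (1 / w $ 2) * cmod (f w)"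
          unfolding T_def C_def n_def
          by (intro mult_right_mono hartogs_kernel_part_summand_bound z True i) auto
        with True \<open>C \<ge> 0\<close> show ?thesis by (simp add: norm_mult norm_divide abs_mult)
      qed simp
    qed
  qed
  have z2: "z $ 2 \<in> punctured_disc" "z $ 2 \<noteq> 0"
    using hartogs_triangle_bounds[OF k z] by (auto simp: punctured_disc_def)
  define E where "E b = (of_real \<nu> + (1 - of_real \<nu>) * (z $ 2 * cnj b)) / (1 - z $ 2 * cnj b)\<^sup>2" for b
  define d where "d = of_real pi * of_nat k * (z $ 1) ^ n / (of_nat (n + 1) * (z $ 2) ^ Suc \<alpha>)"
  have "AE b in lborel. indicator punctured_disc b *\<^sub>R (LINT a:fibre k b|lborel. T (vec2 a b) * f (vec2 a b)) =
      indicator punctured_disc b *\<^sub>R (d * (of_real (cmod b powr (2 * \<nu> - 2)) * (E b * (b ^ Suc \<alpha> * c b))))"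
    using AE_integrable_fibre[OF k f2]
  proof eventually_elim
    case (elim b)
    show ?case
    proof (cases "b \<in> punctured_disc")
      case True
      then have b: "b \<noteq> 0" by (simp add: punctured_disc_def)
      define g where "g a = f (vec2 a b)" for a
      have hol: "g holomorphic_on fibre k b"
        unfolding g_def by (rule holomorphic_on_fibre[OF k f1 True])
      have intg: "set_integrable lborel (fibre k b) g"
        by (rule set_integrable_if_square_integrable)
           (use elim True emeasure_lborel_ball_finite holomorphic_on_imp_continuous_on[OF hol] in \<open>auto simp: g_def\<close>)
      \<comment> \<open>The factor \<open>cmod b ^ (2 * Suc \<alpha>)\<close> cancels the antiholomorphic denominator
          \<open>cnj b ^ Suc \<alpha>\<close> and leaves \<open>b ^ Suc \<alpha>\<close>.\<close>
      have R: "(cmod b powr (1 / real k)) ^ (2 * n + 2) = cmod b powr (2 * \<nu> - 2) * cmod b ^ (2 * Suc \<alpha>)"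
      proof -
        have "real (2 * n + 2) / real k = (2 * \<nu> - 2) + real (2 * Suc \<alpha>)"
          using k by (simp add: \<nu>_def n_def field_simps)
        moreover have "cmod b powr real (2 * Suc \<alpha>) = cmod b ^ (2 * Suc \<alpha>)"
          using b by (intro powr_realpow) simp
        ultimately show ?thesis
          using fibre_radius_power[OF k b, of "2 * n + 2"] by (simp only: powr_add)
      qed
      have "(LINT a:fibre k b|lborel. T (vec2 a b) * f (vec2 a b)) =
          (LINT a:fibre k b|lborel. ((z $ 1) ^ n * progression_kernel k i (z $ 2 * cnj b) / (z $ 2 * cnj b) ^ Suc \<alpha>)
             * (cnj a ^ n * g a))"
        by (simp add: T_def g_def power_mult_distrib mult_ac)
      also have "\<dots> = ((z $ 1) ^ n * progression_kernel k i (z $ 2 * cnj b) / (z $ 2 * cnj b) ^ Suc \<alpha>) *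
          (c b * of_real (pi * (cmod b powr (1 / real k)) ^ (2 * n + 2) / (real n + 1)))"
        using integral_moment_unweighted[OF hol _ intg, of n] b
        by (simp add: c_def g_def [abs_def])
      also have "\<dots> = d * (of_real (cmod b powr (2 * \<nu> - 2)) * (E b * (b ^ Suc \<alpha> * c b)))"
      proof -
        have bb: "complex_of_real (cmod b ^ (2 * Suc \<alpha>)) = cnj b ^ Suc \<alpha> * b ^ Suc \<alpha>"
          by (rule cmod_power_mult_cnj[symmetric])
        have kE: "progression_kernel k i (z $ 2 * cnj b) = of_nat k * E b"
          unfolding E_def \<nu>_def by (rule progression_kernel_eq[OF i])
        have n1: "complex_of_real (real n + 1) = of_nat (n + 1)" by simp
        have "of_nat (n + 1) \<noteq> (0 :: complex)" by (simp del: of_nat_Suc of_nat_add)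
        moreover have "cnj b ^ Suc \<alpha> \<noteq> 0" "(z $ 2) ^ Suc \<alpha> \<noteq> 0" using b z2 by auto
        moreover have "P * (K * e) / (Y * X) * (C * (p * (W * (X * B)) / N)) = p * K * P / (N * Y) * (W * (e * (B * C)))"
          if "N \<noteq> 0" "X \<noteq> 0" "Y \<noteq> 0" for P K e Y X C p W B N :: complex
          using that by (simp add: field_simps)
        ultimately show ?thesis
          unfolding R kE d_def of_real_divide of_real_mult bb n1 power_mult_distrib[of "z $ 2"] by blast
      qed
      finally show ?thesis by simp
    qed simp
  qed
  note ae = this
  have ccont: "continuous_on punctured_disc c"
    unfolding c_def by (rule holomorphic_on_imp_continuous_on[OF holomorphic_on_fibre_coeff[OF k f1]])
  have "continuous_on punctured_disc (\<lambda>b. d * (of_real (cmod b powr (2 * \<nu> - 2)) * (E b * (b ^ Suc \<alpha> * c b))))"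
  proof -
    have "1 - z $ 2 * cnj b \<noteq> 0" if "b \<in> punctured_disc" for b
    proof -
      have "cmod (z $ 2) * cmod b < 1 * 1"
        using that z2 by (intro mult_strict_mono') (auto simp: punctured_disc_def)
      then have "cmod (z $ 2 * cnj b) < 1" by (simp add: norm_mult)
      then show ?thesis by auto
    qed
    then show ?thesis
      unfolding E_def by (intro continuous_intros ccont) (auto simp: punctured_disc_def)
  qed
  then have meas: "(\<lambda>b. indicator punctured_disc b *\<^sub>R (d * (of_real (cmod b powr (2 * \<nu> - 2)) * (E b * (b ^ Suc \<alpha> * c b)))))
      \<in> borel_measurable lborel"
    using borel_measurable_continuous_on_indicator[OF punctured_disc_sets] by simp
  have "(LINT w:?H|lborel. T w * f w) = (LINT b:punctured_disc|lborel. LINT a:fibre k b|lborel. T (vec2 a b) * f (vec2 a b))"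
    by (rule integral_hartogs_triangle[OF k int])
  also have "\<dots> = (LINT b:punctured_disc|lborel. d * (of_real (cmod b powr (2 * \<nu> - 2)) * (E b * (b ^ Suc \<alpha> * c b))))"
    unfolding set_lebesgue_integral_def[where A = punctured_disc]
    using integrable_integral_fibre[OF k int] meas ae
    by (intro integral_cong_AE) (auto simp: set_integrable_def)
  also have "\<dots> = d * (LINT b:punctured_disc|lborel. of_real (cmod b powr (2 * \<nu> - 2)) * (E b * (b ^ Suc \<alpha> * c b)))"
    by (rule set_integral_mult_right)
  also have "\<dots> = d * (of_real pi * ((z $ 2) ^ Suc \<alpha> * c (z $ 2)))"
    unfolding E_def \<nu>_def c_def n_def using fibre_coeff_reproducing[OF k f i z2(1), of \<alpha>] by simp
  finally have "(LINT w:?H|lborel. T w * f w) = d * (of_real pi * ((z $ 2) ^ Suc \<alpha> * c (z $ 2)))" .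
  moreover have "of_nat (n + 1) \<noteq> (0 :: complex)" by (simp del: of_nat_Suc of_nat_add)
  ultimately show "of_nat (n + 1) * (LINT w:?H|lborel. T w * f w) =
      of_nat k * of_real pi ^ 2 * (taylor_coeff (\<lambda>a. f (vec2 a (z $ 2))) n * (z $ 1) ^ n)"
    using z2(2) by (simp add: d_def c_def power2_eq_square del: of_nat_Suc of_nat_add)
qed

lemma integral_hartogs_kernel_part:
  fixes z :: "complex ^ 2"
  assumes f: "f \<in> bergman_space (hartogs_triangle (real k))"
    and z: "z \<in> hartogs_triangle (real k)" and i: "i < k"
  shows "set_integrable lborel (hartogs_triangle (real k)) (\<lambda>w. hartogs_kernel_part k i z w * f w)"
    and "(\<lambda>\<alpha>. of_nat k * of_real pi ^ 2 *
      (taylor_coeff (\<lambda>a. f (vec2 a (z $ 2))) (k * \<alpha> + i) * (z $ 1) ^ (k * \<alpha> + i)))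
      sums (LINT w:hartogs_triangle (real k)|lborel. hartogs_kernel_part k i z w * f w)"
proof -
  let ?H = "hartogs_triangle (real k)"
  define T where "T \<alpha> w = (z $ 1 * cnj (w $ 1)) ^ (k * \<alpha> + i) *
      progression_kernel k i (z $ 2 * cnj (w $ 2)) / (z $ 2 * cnj (w $ 2)) ^ Suc \<alpha>" for \<alpha> and w :: "complex ^ 2"
  define F where "F \<alpha> w = of_nat (k * \<alpha> + i + 1) * (indicator ?H w *\<^sub>R (T \<alpha> w * f w))" for \<alpha> w
  define \<rho> where "\<rho> = cmod (z $ 1) ^ k / cmod (z $ 2)"
  define B where "B = real k / (1 - cmod (z $ 2))\<^sup>2 / cmod (z $ 2)"
  define G where "G w = B * norm (indicator ?H w *\<^sub>R (1 / w $ 2 * f w))" for w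
  note summand = integral_hartogs_kernel_part_summand[OF f z i, folded T_def]
  have \<rho>: "0 \<le> \<rho>" "\<rho> < 1"
    using hartogs_ratio_bounds(2)[OF k z z] by (auto simp: \<rho>_def)
  have G: "integrable lborel G"
    unfolding G_def using integrable_over_second[OF k f] unfolding set_integrable_def
    by (intro integrable_mult_right integrable_norm)
  have intF: "integrable lborel (F \<alpha>)" for \<alpha>
    unfolding F_def using summand(1)[of \<alpha>] unfolding set_integrable_def by (rule integrable_mult_right)
  have bound: "cmod (F \<alpha> w) \<le> real (k * \<alpha> + i + 1) * \<rho> ^ \<alpha> * G w" for \<alpha> w
  proof (cases "w \<in> ?H")
    case True
    have "cmod (T \<alpha> w) * cmod (f w) \<le> \<rho> ^ \<alpha> * B * cmod (1 / w $ 2) * cmod (f w)"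
      unfolding T_def \<rho>_def B_def
      by (intro mult_right_mono hartogs_kernel_part_summand_bound z True i) auto
    then have "real (k * \<alpha> + i + 1) * (cmod (T \<alpha> w) * cmod (f w)) \<le>
        real (k * \<alpha> + i + 1) * (\<rho> ^ \<alpha> * B * cmod (1 / w $ 2) * cmod (f w))"
      by (intro mult_left_mono) auto
    moreover have "cmod (F \<alpha> w) = real (k * \<alpha> + i + 1) * (cmod (T \<alpha> w) * cmod (f w))"
      using True by (simp add: F_def norm_mult del: of_nat_Suc of_nat_add)
    moreover have "G w = B * cmod (1 / w $ 2) * cmod (f w)"
      using True by (simp add: G_def norm_mult norm_divide)
    ultimately show ?thesis by (simp only: mult_ac)
  qed (simp add: F_def G_def)
  have summ: "summable (\<lambda>\<alpha>. real (k * \<alpha> + i + 1) * \<rho> ^ \<alpha>)"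
  proof -
    have "summable (\<lambda>\<alpha>. real k * (real (Suc \<alpha>) * \<rho> ^ \<alpha>) + (real i + 1 - real k) * \<rho> ^ \<alpha>)"
      using \<rho> by (intro summable_add summable_mult summable_geometric sums_summable[OF geometric_deriv_sums]) auto
    then show ?thesis by (simp add: algebra_simps)
  qed
  have AE_summ: "AE w in lborel. summable (\<lambda>\<alpha>. norm (F \<alpha> w))"
  proof (rule AE_I2)
    fix w
    have "summable (\<lambda>\<alpha>. real (k * \<alpha> + i + 1) * \<rho> ^ \<alpha> * G w)"
      using summ by (rule summable_mult2)
    then show "summable (\<lambda>\<alpha>. norm (F \<alpha> w))"
      by (rule summable_comparison_test') (use bound in auto)
  qed
  have int_summ: "summable (\<lambda>\<alpha>. LINT w|lborel. norm (F \<alpha> w))"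
  proof (rule summable_comparison_test'[of _ 0])
    show "summable (\<lambda>\<alpha>. real (k * \<alpha> + i + 1) * \<rho> ^ \<alpha> * (LINT w|lborel. G w))"
      using summ by (rule summable_mult2)
    fix \<alpha>
    have "(LINT w|lborel. norm (F \<alpha> w)) \<le> (LINT w|lborel. real (k * \<alpha> + i + 1) * \<rho> ^ \<alpha> * G w)"
      by (intro integral_mono integrable_norm intF integrable_mult_right G bound)
    then show "norm (LINT w|lborel. norm (F \<alpha> w)) \<le> real (k * \<alpha> + i + 1) * \<rho> ^ \<alpha> * (LINT w|lborel. G w)"
      by simp
  qed
  have pw: "(\<lambda>\<alpha>. F \<alpha> w) sums (indicator ?H w *\<^sub>R (hartogs_kernel_part k i z w * f w))" for w
  proof (cases "w \<in> ?H")
    case True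
    from sums_mult2[OF hartogs_kernel_part_sums[OF z True i], of "f w"] show ?thesis
      using True by (simp add: F_def T_def mult.assoc)
  qed (simp add: F_def)
  then have eq: "(\<lambda>w. \<Sum>\<alpha>. F \<alpha> w) = (\<lambda>w. indicator ?H w *\<^sub>R (hartogs_kernel_part k i z w * f w))"
    by (simp add: sums_iff)
  show "set_integrable lborel ?H (\<lambda>w. hartogs_kernel_part k i z w * f w)"
    using integrable_suminf[OF intF AE_summ int_summ] by (simp add: eq set_integrable_def)
  have "(\<lambda>\<alpha>. integral\<^sup>L lborel (F \<alpha>)) sums (LINT w:?H|lborel. hartogs_kernel_part k i z w * f w)"
    using sums_integral[OF intF AE_summ int_summ] by (simp add: eq set_lebesgue_integral_def)
  moreover have "integral\<^sup>L lborel (F \<alpha>) = of_nat k * of_real pi ^ 2 *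
      (taylor_coeff (\<lambda>a. f (vec2 a (z $ 2))) (k * \<alpha> + i) * (z $ 1) ^ (k * \<alpha> + i))" for \<alpha>
  proof -
    have "integral\<^sup>L lborel (F \<alpha>) = of_nat (k * \<alpha> + i + 1) * (LINT w:?H|lborel. T \<alpha> w * f w)"
      unfolding F_def set_lebesgue_integral_def by (rule integral_mult_right_zero)
    then show ?thesis by (simp only: summand(2))
  qed
  ultimately show "(\<lambda>\<alpha>. of_nat k * of_real pi ^ 2 *
      (taylor_coeff (\<lambda>a. f (vec2 a (z $ 2))) (k * \<alpha> + i) * (z $ 1) ^ (k * \<alpha> + i)))
      sums (LINT w:?H|lborel. hartogs_kernel_part k i z w * f w)"
    by simp
qed

text \<open>
  Each residue class contributes its part of the Taylor series of \<open>f\<close> along the fibre through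
  \<open>z\<close>. Grouping that series into blocks of length \<open>k\<close> puts the parts together.
\<close>

lemma hartogs_kernel_reproducing:
  fixes z :: "complex ^ 2"
  assumes f: "f \<in> bergman_space (hartogs_triangle (real k))"
    and z: "z \<in> hartogs_triangle (real k)"
  shows "(LINT w:hartogs_triangle (real k)|lborel. hartogs_kernel k z w * f w) = f z"
proof -
  let ?H = "hartogs_triangle (real k)"
  define P where "P = of_nat k * complex_of_real pi ^ 2"
  have P: "P \<noteq> 0" using k by (simp add: P_def)
  define c where "c n = taylor_coeff (\<lambda>a. f (vec2 a (z $ 2))) n * (z $ 1) ^ n" for n
  have "vec2 (z $ 1) (z $ 2) \<in> ?H" using z by simp
  then have z12: "z $ 2 \<in> punctured_disc" "z $ 1 \<in> fibre k (z $ 2)"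
    unfolding vec2_mem_hartogs_triangle[OF k] by auto
  have "c sums f (vec2 (z $ 1) (z $ 2))"
    unfolding c_def
    by (rule taylor_coeff_sums[OF holomorphic_on_fibre[OF k _ z12(1)]])
       (use f z12 in \<open>auto simp: bergman_space_def\<close>)
  then have "(\<lambda>\<alpha>. sum c {\<alpha> * k..<\<alpha> * k + k}) sums f z"
    using sums_group[of c "f z" k] k by simp
  moreover have "sum c {\<alpha> * k..<\<alpha> * k + k} = (\<Sum>i<k. c (k * \<alpha> + i))" for \<alpha>
    using sum.shift_bounds_nat_ivl[of c 0 "\<alpha> * k" k] by (simp add: atLeast0LessThan ac_simps)
  ultimately have 1: "(\<lambda>\<alpha>. P * (\<Sum>i<k. c (k * \<alpha> + i))) sums (P * f z)"
    by (intro sums_mult) simp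
  have "(\<lambda>\<alpha>. \<Sum>i<k. P * c (k * \<alpha> + i)) sums (\<Sum>i<k. LINT w:?H|lborel. hartogs_kernel_part k i z w * f w)"
    unfolding P_def c_def using integral_hartogs_kernel_part(2)[OF f z] by (intro sums_sum) auto
  then have 2: "P * f z = (\<Sum>i<k. LINT w:?H|lborel. hartogs_kernel_part k i z w * f w)"
    using 1 by (simp add: sum_distrib_left sums_iff)
  have "(\<Sum>i<k. LINT w:?H|lborel. hartogs_kernel_part k i z w * f w) =
      (LINT w:?H|lborel. (\<Sum>i<k. hartogs_kernel_part k i z w * f w))"
    using integral_hartogs_kernel_part(1)[OF f z]
    unfolding set_lebesgue_integral_def set_integrable_def scaleR_sum_right
    by (subst Bochner_Integration.integral_sum) auto
  also have "(\<lambda>w. \<Sum>i<k. hartogs_kernel_part k i z w * f w) = (\<lambda>w. P * (hartogs_kernel k z w * f w))"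
    using P by (intro ext) (simp add: hartogs_kernel_def flip: P_def sum_distrib_right)
  also have "(LINT w:?H|lborel. P * (hartogs_kernel k z w * f w)) = P * (LINT w:?H|lborel. hartogs_kernel k z w * f w)"
    by (rule set_integral_mult_right)
  finally show ?thesis using 2 P by simp
qed

end

section \<open>Membership of the kernel in the Bergman space\<close>
lemma holomorphic_several_on_const: "holomorphic_several_on (\<lambda>_. c) \<Omega>"
  unfolding holomorphic_several_on_def by (auto intro!: exI[of _ "\<lambda>_. 0"])

lemma holomorphic_several_on_nth: "holomorphic_several_on (\<lambda>w :: complex ^ 'n. w $ j) \<Omega>"
  unfolding holomorphic_several_on_def
  by (auto intro!: exI[of _ "\<lambda>v. v $ j"] bounded_linear_imp_has_derivative bounded_linear_vec_nth)

lemma holomorphic_several_on_add: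
  assumes "holomorphic_several_on f \<Omega>" "holomorphic_several_on g \<Omega>"
  shows "holomorphic_several_on (\<lambda>w. f w + g w) \<Omega>"
  unfolding holomorphic_several_on_def
proof
  fix w assume "w \<in> \<Omega>"
  then obtain D E where D: "(f has_derivative D) (at w within \<Omega>)" "\<And>c v. D (c *s v) = c * D v"
    and E: "(g has_derivative E) (at w within \<Omega>)" "\<And>c v. E (c *s v) = c * E v"
    using assms unfolding holomorphic_several_on_def by metis
  show "\<exists>D. ((\<lambda>w. f w + g w) has_derivative D) (at w within \<Omega>) \<and> (\<forall>c v. D (c *s v) = c * D v)"
    using has_derivative_add[OF D(1) E(1)] D(2) E(2)
    by (intro exI[of _ "\<lambda>v. D v + E v"]) (simp add: distrib_left)
qed

lemma holomorphic_several_on_mult: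
  assumes "holomorphic_several_on f \<Omega>" "holomorphic_several_on g \<Omega>"
  shows "holomorphic_several_on (\<lambda>w. f w * g w) \<Omega>"
  unfolding holomorphic_several_on_def
proof
  fix w assume "w \<in> \<Omega>"
  then obtain D E where D: "(f has_derivative D) (at w within \<Omega>)" "\<And>c v. D (c *s v) = c * D v"
    and E: "(g has_derivative E) (at w within \<Omega>)" "\<And>c v. E (c *s v) = c * E v"
    using assms unfolding holomorphic_several_on_def by metis
  show "\<exists>D. ((\<lambda>w. f w * g w) has_derivative D) (at w within \<Omega>) \<and> (\<forall>c v. D (c *s v) = c * D v)"
    using has_derivative_mult[OF D(1) E(1)] D(2) E(2)
    by (intro exI[of _ "\<lambda>v. f w * E v + D v * g w"]) (simp add: algebra_simps)
qed

lemma holomorphic_several_on_inverse: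
  assumes "holomorphic_several_on f \<Omega>" and nz: "\<And>w. w \<in> \<Omega> \<Longrightarrow> f w \<noteq> 0"
  shows "holomorphic_several_on (\<lambda>w. inverse (f w)) \<Omega>"
  unfolding holomorphic_several_on_def
proof
  fix w assume w: "w \<in> \<Omega>"
  then obtain D where D: "(f has_derivative D) (at w within \<Omega>)" "\<And>c v. D (c *s v) = c * D v"
    using assms unfolding holomorphic_several_on_def by metis
  show "\<exists>D. ((\<lambda>w. inverse (f w)) has_derivative D) (at w within \<Omega>) \<and> (\<forall>c v. D (c *s v) = c * D v)"
    using Deriv.has_derivative_inverse[OF nz[OF w] D(1)] D(2)
    by (intro exI[of _ "\<lambda>v. - (inverse (f w) * D v * inverse (f w))"]) simp
qed

lemma holomorphic_several_on_power:
  "holomorphic_several_on f \<Omega> \<Longrightarrow> holomorphic_several_on (\<lambda>w. f w ^ n) \<Omega>"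
  by (induction n) (simp_all add: holomorphic_several_on_const holomorphic_several_on_mult)

lemma holomorphic_several_on_sum:
  assumes "\<And>i. i \<in> I \<Longrightarrow> holomorphic_several_on (f i) \<Omega>"
  shows "holomorphic_several_on (\<lambda>w. \<Sum>i\<in>I. f i w) \<Omega>"
  using assms
  by (induction I rule: infinite_finite_induct)
     (simp_all add: holomorphic_several_on_const holomorphic_several_on_add)

lemmas holomorphic_several_intros = holomorphic_several_on_const holomorphic_several_on_nth
  holomorphic_several_on_add holomorphic_several_on_diff holomorphic_several_on_mult
  holomorphic_several_on_inverse holomorphic_several_on_power holomorphic_several_on_sum

lemma cnj_hartogs_kernel: "cnj (hartogs_kernel k z w) = hartogs_kernel k w z"
  by (simp add: hartogs_kernel_def hartogs_kernel_part_def progression_kernel_def Let_def mult.commute)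

context
  fixes k :: nat
  assumes k: "k > 0"
begin

lemma holomorphic_several_on_hartogs_kernel:
  fixes z :: "complex ^ 2"
  assumes z: "z \<in> hartogs_triangle (real k)"
  shows "holomorphic_several_on (\<lambda>w. hartogs_kernel k w z) (hartogs_triangle (real k))"
proof -
  have "w $ 2 * cnj (z $ 2) \<noteq> 0" "1 - w $ 2 * cnj (z $ 2) \<noteq> 0"
    "1 - (w $ 1 * cnj (z $ 1)) ^ k / (w $ 2 * cnj (z $ 2)) \<noteq> 0"
    if w: "w \<in> hartogs_triangle (real k)" for w :: "complex ^ 2"
    using hartogs_ratio_bounds[OF k w z] hartogs_triangle_bounds[OF k w] by auto
  then show ?thesis
    unfolding hartogs_kernel_def hartogs_kernel_part_def progression_kernel_def Let_def divide_inverse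
    by (intro holomorphic_several_intros) (auto simp: divide_inverse)
qed

lemma hartogs_kernel_in_bergman_space:
  fixes z :: "complex ^ 2"
  assumes z: "z \<in> hartogs_triangle (real k)"
  shows "(\<lambda>w. cnj (hartogs_kernel k z w)) \<in> bergman_space (hartogs_triangle (real k))"
proof -
  let ?H = "hartogs_triangle (real k)"
  have hol: "holomorphic_several_on (\<lambda>w. cnj (hartogs_kernel k z w)) ?H"
    using holomorphic_several_on_hartogs_kernel[OF z] by (simp add: cnj_hartogs_kernel)
  obtain C where C: "\<And>i w. i < k \<Longrightarrow> w \<in> ?H \<Longrightarrow> cmod (hartogs_kernel_part k i z w) \<le> C i / cmod (w $ 2)"
    using cmod_hartogs_kernel_part_le[OF k z] by metis
  define M where "M = (\<Sum>i<k. C i) / (real k * pi\<^sup>2)"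
  have bound: "cmod (hartogs_kernel k z w) \<le> M * cmod (1 / w $ 2)" if w: "w \<in> ?H" for w
  proof -
    have "cmod (hartogs_kernel k z w) = cmod (\<Sum>i<k. hartogs_kernel_part k i z w) / (real k * pi\<^sup>2)"
      by (simp add: hartogs_kernel_def norm_divide norm_mult norm_power)
    also have "\<dots> \<le> (\<Sum>i<k. C i / cmod (w $ 2)) / (real k * pi\<^sup>2)"
      using C[OF _ w] by (intro divide_right_mono sum_norm_le) auto
    also have "\<dots> = M * cmod (1 / w $ 2)"
      by (simp add: M_def norm_divide sum_divide_distrib mult.commute)
    finally show ?thesis .
  qed
  have "set_integrable lborel ?H (\<lambda>w. (cmod (cnj (hartogs_kernel k z w)))\<^sup>2)"
    unfolding set_integrable_def
  proof (rule Bochner_Integration.integrable_bound)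
    show "integrable lborel (\<lambda>w. M\<^sup>2 * (indicator ?H w *\<^sub>R (cmod (1 / w $ 2))\<^sup>2))"
      using square_integrable_inverse_second[OF k] unfolding set_integrable_def
      by (intro integrable_mult_right)
    show "(\<lambda>w. indicator ?H w *\<^sub>R (cmod (cnj (hartogs_kernel k z w)))\<^sup>2) \<in> borel_measurable lborel"
      using borel_measurable_continuous_on_indicator[of ?H "\<lambda>w. (cmod (cnj (hartogs_kernel k z w)))\<^sup>2"]
        holomorphic_several_on_imp_continuous_on[OF hol] open_hartogs_triangle[OF k]
      by (simp add: continuous_intros del: complex_mod_cnj)
    show "AE w in lborel. norm (indicator ?H w *\<^sub>R (cmod (cnj (hartogs_kernel k z w)))\<^sup>2) \<le>
        norm (M\<^sup>2 * (indicator ?H w *\<^sub>R (cmod (1 / w $ 2))\<^sup>2))"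
    proof (rule AE_I2)
      fix w :: "complex ^ 2"
      show "norm (indicator ?H w *\<^sub>R (cmod (cnj (hartogs_kernel k z w)))\<^sup>2) \<le>
        norm (M\<^sup>2 * (indicator ?H w *\<^sub>R (cmod (1 / w $ 2))\<^sup>2))"
      proof (cases "w \<in> ?H")
        case True
        have "(cmod (hartogs_kernel k z w))\<^sup>2 \<le> (M * cmod (1 / w $ 2))\<^sup>2"
          using bound[OF True] by (intro power_mono) auto
        with True show ?thesis by (simp add: power_mult_distrib norm_mult)
      qed simp
    qed
  qed
  with hol show ?thesis by (simp add: bergman_space_def)
qed

lemma is_bergman_kernel_hartogs_kernel:
  "is_bergman_kernel (hartogs_triangle (real k)) (hartogs_kernel k)"
  unfolding is_bergman_kernel_def
  using hartogs_kernel_in_bergman_space hartogs_kernel_reproducing[OF k] by metis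

end

section \<open>Closed form and identification of the kernel\<close>

text \<open>
  Extending \<open>K\<close> by zero outside \<open>\<Omega>\<close> affects neither holomorphy on \<open>\<Omega>\<close> nor
  integrals over \<open>\<Omega>\<close>, and the extension is unique as a total function.
\<close>

lemma bergman_kernel_eqI:
  assumes "open \<Omega>" and K: "is_bergman_kernel \<Omega> K" and zw: "z \<in> \<Omega>" "w \<in> \<Omega>"
  shows "bergman_kernel \<Omega> z w = K z w"
proof -
  define L where "L = (\<lambda>z w. if z \<in> \<Omega> \<and> w \<in> \<Omega> then K z w else 0)"
  have L: "is_bergman_kernel \<Omega> L"
    unfolding is_bergman_kernel_def
  proof (intro ballI conjI)
    fix z assume z: "z \<in> \<Omega>"
    have A: "holomorphic_several_on (\<lambda>w. cnj (K z w)) \<Omega>"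
      and B: "set_integrable lborel \<Omega> (\<lambda>w. (cmod (cnj (K z w)))\<^sup>2)"
      using K z by (auto simp: is_bergman_kernel_def bergman_space_def)
    have "holomorphic_several_on (\<lambda>w. cnj (L z w)) \<Omega>"
      unfolding holomorphic_several_on_def
    proof
      fix w assume w: "w \<in> \<Omega>"
      then obtain D where D: "((\<lambda>w. cnj (K z w)) has_derivative D) (at w within \<Omega>)" "\<forall>c v. D (c *s v) = c * D v"
        using A unfolding holomorphic_several_on_def by blast
      have "((\<lambda>w. cnj (L z w)) has_derivative D) (at w within \<Omega>)"
        by (rule has_derivative_transform[OF w _ D(1)]) (use z in \<open>simp add: L_def\<close>)
      with D(2) show "\<exists>D. ((\<lambda>w. cnj (L z w)) has_derivative D) (at w within \<Omega>) \<and> (\<forall>c v. D (c *s v) = c * D v)"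
        by blast
    qed
    moreover have "set_integrable lborel \<Omega> (\<lambda>w. (cmod (cnj (L z w)))\<^sup>2)"
    proof -
      have "indicator \<Omega> w *\<^sub>R (cmod (cnj (L z w)))\<^sup>2 = indicator \<Omega> w *\<^sub>R (cmod (cnj (K z w)))\<^sup>2" for w
        using z by (simp add: L_def indicator_def)
      with B show ?thesis by (simp only: set_integrable_def)
    qed
    ultimately show "(\<lambda>w. cnj (L z w)) \<in> bergman_space \<Omega>"
      by (simp add: bergman_space_def)
    fix f assume f: "f \<in> bergman_space \<Omega>"
    have "indicator \<Omega> w *\<^sub>R (L z w * f w) = indicator \<Omega> w *\<^sub>R (K z w * f w)" for w
      using z by (simp add: L_def indicator_def)
    then have "(LINT w:\<Omega>|lborel. L z w * f w) = (LINT w:\<Omega>|lborel. K z w * f w)"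
      by (simp only: set_lebesgue_integral_def)
    then show "f z = (LINT w:\<Omega>|lborel. L z w * f w)"
      using K z f by (simp add: is_bergman_kernel_def)
  qed
  have "bergman_kernel \<Omega> = L"
    unfolding bergman_kernel_def
  proof (rule the_equality)
    show "is_bergman_kernel \<Omega> L \<and> (\<forall>z w. z \<notin> \<Omega> \<or> w \<notin> \<Omega> \<longrightarrow> L z w = 0)"
      using L by (auto simp: L_def)
    fix M assume M: "is_bergman_kernel \<Omega> M \<and> (\<forall>z w. z \<notin> \<Omega> \<or> w \<notin> \<Omega> \<longrightarrow> M z w = 0)"
    show "M = L"
    proof (intro ext)
      fix z w
      show "M z w = L z w"
      proof (cases "z \<in> \<Omega> \<and> w \<in> \<Omega>")
        case True
        with is_bergman_kernel_unique[OF assms(1) conjunct1[OF M] L] show ?thesis by blast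
      next
        case False
        with M show ?thesis by (auto simp: L_def)
      qed
    qed
  qed
  with zw show ?thesis by (simp add: L_def)
qed

text \<open>
  Clearing denominators, \<open>progression_kernel k i (s ^ k / t)\<close> divided by \<open>t\<close> is
  \<open>((i + 1) * t + (k - i - 1) * s ^ k) / (t - s ^ k)\<^sup>2\<close>. Multiplying this by the numerator
  \<open>(i + 1) + (k - i - 1) * t\<close> of the other factor and sorting by powers of \<open>t\<close> gives the
  coefficients of the polynomials \<open>p\<close>, \<open>q\<close> and \<open>s ^ k * p\<close>.
\<close>

lemma hartogs_kernel_closed_form:
  fixes z w :: "complex ^ 2"
  assumes k: "k > 0" and z: "z \<in> hartogs_triangle (real k)" and w: "w \<in> hartogs_triangle (real k)"
  defines "s \<equiv> z $ 1 * cnj (w $ 1)" and "t \<equiv> z $ 2 * cnj (w $ 2)"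
  shows "hartogs_kernel k z w = (p_poly k s * t ^ 2 + q_poly k s * t + s ^ k * p_poly k s) /
      (of_nat k * of_real pi ^ 2 * (1 - t) ^ 2 * (t - s ^ k) ^ 2)"
proof -
  note b = hartogs_ratio_bounds[OF k z w, folded s_def t_def]
  have t: "t \<noteq> 0" by (rule b(5))
  define D where "D = (1 - t)\<^sup>2 * (t - s ^ k)\<^sup>2"
  have part: "hartogs_kernel_part k i z w =
      s ^ i * ((of_nat (Suc i) * t + of_nat (k - Suc i) * s ^ k) * (of_nat (Suc i) + of_nat (k - Suc i) * t)) / D" for i
  proof -
    have "1 - s ^ k / t = (t - s ^ k) / t" using t by (simp add: diff_divide_distrib)
    then have "progression_kernel k i (s ^ k / t) =
        (of_nat (Suc i) + of_nat (k - Suc i) * (s ^ k / t)) / ((t - s ^ k) / t)\<^sup>2"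
      by (simp only: progression_kernel_def)
    also have "of_nat (Suc i) + of_nat (k - Suc i) * (s ^ k / t) = (of_nat (Suc i) * t + of_nat (k - Suc i) * s ^ k) / t"
      using t by (simp add: add_divide_distrib del: of_nat_Suc)
    also have "(of_nat (Suc i) * t + of_nat (k - Suc i) * s ^ k) / t / ((t - s ^ k) / t)\<^sup>2 =
        (of_nat (Suc i) * t + of_nat (k - Suc i) * s ^ k) * t / (t - s ^ k)\<^sup>2"
      using t by (simp add: power_divide power2_eq_square del: of_nat_Suc)
    finally have "progression_kernel k i (s ^ k / t) =
        (of_nat (Suc i) * t + of_nat (k - Suc i) * s ^ k) * t / (t - s ^ k)\<^sup>2" .
    then show ?thesis
      using t unfolding hartogs_kernel_part_def Let_def s_def[symmetric] t_def[symmetric]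
      by (simp add: progression_kernel_def D_def mult_ac del: of_nat_Suc)
  qed
  have p: "p_poly k s = (\<Sum>i<k. of_nat (Suc i) * of_nat (k - Suc i) * s ^ i)"
  proof -
    \<comment> \<open>The last summand \<open>i = k - 1\<close> vanishes, so the range \<open>1..k - 1\<close> may be extended.\<close>
    obtain m where m: "k = Suc m" using k by (cases k) auto
    have "p_poly k s = (\<Sum>i<m. of_nat (Suc i) * of_nat (k - Suc i) * s ^ i)"
      unfolding p_poly_def m by (simp add: sum.atLeast1_atMost_eq)
    then show ?thesis by (simp add: m del: of_nat_Suc)
  qed
  have q: "q_poly k s = (\<Sum>i<k. (of_nat (Suc i) ^ 2 + of_nat (k - Suc i) ^ 2 * s ^ k) * s ^ i)"
    unfolding q_poly_def by (simp add: sum.atLeast1_atMost_eq del: of_nat_Suc)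
  have "(\<Sum>i<k. hartogs_kernel_part k i z w) = (\<Sum>i<k. of_nat (Suc i) * of_nat (k - Suc i) * s ^ i * t ^ 2 +
      (of_nat (Suc i) ^ 2 + of_nat (k - Suc i) ^ 2 * s ^ k) * s ^ i * t + s ^ k * (of_nat (Suc i) * of_nat (k - Suc i) * s ^ i)) / D"
    unfolding part sum_divide_distrib
    by (intro sum.cong refl arg_cong[where f = "\<lambda>x. x / D"])
       (simp add: power2_eq_square algebra_simps del: of_nat_Suc)
  also have "\<dots> = (p_poly k s * t ^ 2 + q_poly k s * t + s ^ k * p_poly k s) / D"
    unfolding p q by (simp only: sum.distrib sum_distrib_left sum_distrib_right)
  finally show ?thesis
    unfolding hartogs_kernel_def by (simp add: D_def mult_ac)
qed

theorem theorem1p2: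
  fixes k :: nat and z w :: "complex ^ 2"
  assumes "k > 0"
    and "z \<in> hartogs_triangle (real k)" and "w \<in> hartogs_triangle (real k)"
  shows "bergman_kernel (hartogs_triangle (real k)) z w =
    (let s = z $ 1 * cnj (w $ 1); t = z $ 2 * cnj (w $ 2) in
      (p_poly k s * t ^ 2 + q_poly k s * t + s ^ k * p_poly k s) /
      (of_nat k * of_real pi ^ 2 * (1 - t) ^ 2 * (t - s ^ k) ^ 2))"
  using bergman_kernel_eqI[OF open_hartogs_triangle[OF assms(1)]
      is_bergman_kernel_hartogs_kernel[OF assms(1)] assms(2,3)]
    hartogs_kernel_closed_form[OF assms]
  by (simp add: Let_def)

end
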